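(* Let $\Omega\subseteq\mathbb{R}^n$ be an open, connected, convex set with smooth boundary (the case $\Omega=\mathbb{R}^n$ being allowed) satisfying the interior cone condition, let $T>0$, $Q_T=\Omega\times(0,T)$ and $\Sigma_T=\partial\Omega\times(0,T)$. Let $u$ be a positive solution to $$\begin{cases}\partial_t u-\Delta u=0&\text{in }Q_T,\\ \partial_\nu u=0&\text{on }\Sigma_T,\end{cases}$$ such that $Du\in L^\infty(Q_T)$ and $u\in L^2(0,T;W^{4,2}(\Omega))$. Then $$\Delta(\log u(x,\tau))=\frac{\partial_t u(x,\tau)}{u(x,\tau)}-\frac{|Du(x,\tau)|^2}{u^2(x,\tau)}\ \ge\ -\frac{n}{2\tau}\qquad\text{for any }x\in\Omega\text{ and any }\tau\in(0,T).$$
   Context: $D$ and $\Delta$ are the gradient and Laplacian in the $x$-variable; $\nu$ is the outward normal to $\partial\Omega$. When $\Omega=\mathbb{R}^n$ no boundary condition appears. Solutions $u$ of the heat equation are smooth in $Q_T$ and up to the boundary points on $\Sigma_T$, and extend continuously up to $t=0$. Interior cone condition: there exists a finite cone such that every point of $\Omega$ is the vertex of a cone congruent to the given one and contained in $\Omega$. *)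

theory Defs
  imports "HOL-Analysis.Analysis" "HOL-Probability.Essential_Supremum"
begin

subsection \<open>Classical derivatives and smoothness\<close>

text \<open>A list \<open>[b\<^sub>1, \<dots>, b\<^sub>k]\<close> of basis vectors encodes the iterated partial derivative
  \<open>\<partial>\<^sub>b\<^sub>1 \<dots> \<partial>\<^sub>b\<^sub>k\<close>; the lists of length \<open>k\<close> enumerate all (ordered) partial derivatives of
  order \<open>k\<close>.\<close>

primrec pderivs :: "'a list \<Rightarrow> ('a::euclidean_space \<Rightarrow> real) \<Rightarrow> 'a \<Rightarrow> real" where
  "pderivs [] f = f"
| "pderivs (b # bs) f = (\<lambda>x. frechet_derivative (pderivs bs f) (at x) b)"

definition grad :: "('a::euclidean_space \<Rightarrow> real) \<Rightarrow> 'a \<Rightarrow> 'a" where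
  "grad f x = (\<Sum>b\<in>Basis. pderivs [b] f x *\<^sub>R b)"

definition laplacian :: "('a::euclidean_space \<Rightarrow> real) \<Rightarrow> 'a \<Rightarrow> real" where
  "laplacian f x = (\<Sum>b\<in>Basis. pderivs [b, b] f x)"

text \<open>To be used for open \<open>S\<close>. Differentiability of the partial derivatives of all orders makes
  them all continuous, so this is \<open>C\<^sup>\<infinity>(S)\<close>.\<close>

definition smooth_on :: "'a::euclidean_space set \<Rightarrow> ('a \<Rightarrow> real) \<Rightarrow> bool" where
  "smooth_on S f \<longleftrightarrow> (\<forall>bs\<in>lists Basis. \<forall>x\<in>S. pderivs bs f differentiable (at x))"

text \<open>Smoothness in the open set \<open>S\<close> and up to the part \<open>B\<close> of its boundary: every partial
  derivative has a continuous extension from \<open>S\<close> to \<open>S \<union> B\<close>.\<close>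

definition smooth_up_to :: "'a::euclidean_space set \<Rightarrow> 'a set \<Rightarrow> ('a \<Rightarrow> real) \<Rightarrow> bool" where
  "smooth_up_to S B f \<longleftrightarrow> smooth_on S f \<and>
     (\<forall>bs\<in>lists Basis. \<exists>g. continuous_on (S \<union> B) g \<and> (\<forall>x\<in>S. g x = pderivs bs f x))"


subsection \<open>Domains\<close>

definition local_defining_function ::
    "'a::euclidean_space set \<Rightarrow> 'a set \<Rightarrow> ('a \<Rightarrow> real) \<Rightarrow> bool" where
  "local_defining_function \<Omega> U \<phi> \<longleftrightarrow>
     open U \<and> smooth_on U \<phi> \<and> (\<forall>y\<in>U. grad \<phi> y \<noteq> 0) \<and> \<Omega> \<inter> U = {y \<in> U. \<phi> y < 0}"

definition smooth_boundary :: "'a::euclidean_space set \<Rightarrow> bool" where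
  "smooth_boundary \<Omega> \<longleftrightarrow>
     (\<forall>x\<in>frontier \<Omega>. \<exists>U \<phi>. x \<in> U \<and> local_defining_function \<Omega> U \<phi>)"

text \<open>The gradient of a local defining function points out of \<open>\<Omega>\<close>, since \<open>\<phi> < 0\<close> inside. At a
  point of a smooth boundary the vector \<open>\<nu>\<close> exists and does not depend on the choice of \<open>\<phi>\<close>.\<close>

definition outward_unit_normal :: "'a::euclidean_space set \<Rightarrow> 'a \<Rightarrow> 'a \<Rightarrow> bool" where
  "outward_unit_normal \<Omega> x \<nu> \<longleftrightarrow> x \<in> frontier \<Omega> \<and>
     (\<exists>U \<phi>. x \<in> U \<and> local_defining_function \<Omega> U \<phi> \<and> \<nu> = grad \<phi> x /\<^sub>R norm (grad \<phi> x))"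

text \<open>The derivative at the boundary point \<open>x\<close> is taken from within \<open>closure \<Omega>\<close>, where \<open>f\<close> is
  defined.\<close>

definition has_normal_derivative ::
    "'a::euclidean_space set \<Rightarrow> ('a \<Rightarrow> real) \<Rightarrow> real \<Rightarrow> 'a \<Rightarrow> bool" where
  "has_normal_derivative \<Omega> f d x \<longleftrightarrow>
     (\<forall>\<nu>. outward_unit_normal \<Omega> x \<nu> \<longrightarrow>
       (\<exists>L. (f has_derivative L) (at x within closure \<Omega>) \<and> L \<nu> = d))"

text \<open>The finite cone with vertex \<open>z\<close>, unit axis direction \<open>v\<close>, height \<open>\<rho>\<close> and half-angle \<open>\<theta>\<close>.
  The cones congruent to it are those with the same \<open>\<rho>\<close> and \<open>\<theta>\<close>.\<close>

definition finite_cone :: "'a::euclidean_space \<Rightarrow> 'a \<Rightarrow> real \<Rightarrow> real \<Rightarrow> 'a set" where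
  "finite_cone z v \<rho> \<theta> = {z + y | y. norm y \<le> \<rho> \<and> norm y * cos \<theta> \<le> y \<bullet> v}"

definition interior_cone_condition :: "'a::euclidean_space set \<Rightarrow> bool" where
  "interior_cone_condition \<Omega> \<longleftrightarrow>
     (\<exists>\<rho> \<theta>. 0 < \<rho> \<and> 0 < \<theta> \<and> \<theta> < pi / 2 \<and>
       (\<forall>x\<in>\<Omega>. \<exists>v. norm v = 1 \<and> finite_cone x v \<rho> \<theta> \<subseteq> \<Omega>))"


subsection \<open>Function spaces\<close>

definition L_infinity :: "'a::euclidean_space set \<Rightarrow> ('a \<Rightarrow> 'b::euclidean_space) set" where
  "L_infinity S = {f \<in> borel_measurable (lebesgue_on S).
     esssup (lebesgue_on S) (\<lambda>x. ereal (norm (f x))) < \<infinity>}"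

definition L2 :: "'a::euclidean_space set \<Rightarrow> ('a \<Rightarrow> real) set" where
  "L2 S = {f \<in> borel_measurable (lebesgue_on S). integrable (lebesgue_on S) (\<lambda>x. (f x)\<^sup>2)}"

definition locally_integrable :: "'a::euclidean_space set \<Rightarrow> ('a \<Rightarrow> real) \<Rightarrow> bool" where
  "locally_integrable S f \<longleftrightarrow> (\<forall>K. compact K \<and> K \<subseteq> S \<longrightarrow> integrable (lebesgue_on K) f)"

definition test_function :: "'a::euclidean_space set \<Rightarrow> ('a \<Rightarrow> real) \<Rightarrow> bool" where
  "test_function S \<phi> \<longleftrightarrow> smooth_on UNIV \<phi> \<and>
     compact (closure {x. \<phi> x \<noteq> 0}) \<and> closure {x. \<phi> x \<noteq> 0} \<subseteq> S"

definition has_weak_deriv ::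
    "'a::euclidean_space set \<Rightarrow> 'a list \<Rightarrow> ('a \<Rightarrow> real) \<Rightarrow> ('a \<Rightarrow> real) \<Rightarrow> bool" where
  "has_weak_deriv S bs f g \<longleftrightarrow> locally_integrable S f \<and> locally_integrable S g \<and>
     (\<forall>\<phi>. test_function S \<phi> \<longrightarrow>
        (LINT x|lebesgue_on S. f x * pderivs bs \<phi> x)
          = (-1) ^ length bs * (LINT x|lebesgue_on S. g x * \<phi> x))"

text \<open>Weak derivatives are unique up to null sets, so the choice does not matter below.\<close>

definition weak_deriv ::
    "'a::euclidean_space set \<Rightarrow> 'a list \<Rightarrow> ('a \<Rightarrow> real) \<Rightarrow> 'a \<Rightarrow> real" where
  "weak_deriv S bs f = (SOME g. has_weak_deriv S bs f g)"

text \<open>The Sobolev space \<open>W\<^sup>k\<^sup>,\<^sup>2(S)\<close>, as a set of functions rather than of classes modulo null sets.\<close>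

definition sobolev2 :: "nat \<Rightarrow> 'a::euclidean_space set \<Rightarrow> ('a \<Rightarrow> real) set" where
  "sobolev2 k S =
     {f. \<forall>bs\<in>lists Basis. length bs \<le> k \<longrightarrow> (\<exists>g\<in>L2 S. has_weak_deriv S bs f g)}"

text \<open>The norm \<open>(\<Sum>\<^sub>j\<^sub>\<le>\<^sub>k \<parallel>D\<^sup>j f\<parallel>\<^sup>2)\<^sup>1\<^sup>/\<^sup>2\<close>, with the Euclidean norm of the tensor \<open>D\<^sup>j f\<close>; a mixed
  partial derivative is counted once for each order of differentiation. Meaningful on
  \<open>sobolev2 k S\<close>.\<close>

definition sobolev2_norm :: "nat \<Rightarrow> 'a::euclidean_space set \<Rightarrow> ('a \<Rightarrow> real) \<Rightarrow> real" where
  "sobolev2_norm k S f =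
     sqrt (\<Sum>bs\<in>{bs \<in> lists Basis. length bs \<le> k}. LINT x|lebesgue_on S. (weak_deriv S bs f x)\<^sup>2)"

text \<open>The Bochner space \<open>L\<^sup>2(0,T;W\<^sup>k\<^sup>,\<^sup>2(S))\<close>. The existential expresses strong measurability: \<open>w\<close> is
  almost everywhere the limit, in the Sobolev norm, of simple functions with values in
  \<open>W\<^sup>k\<^sup>,\<^sup>2(S)\<close>.\<close>

definition L2_sobolev2 ::
    "real \<Rightarrow> nat \<Rightarrow> 'a::euclidean_space set \<Rightarrow> (real \<Rightarrow> 'a \<Rightarrow> real) set" where
  "L2_sobolev2 T k S = {w.
     (AE t in lebesgue_on {0<..<T}. w t \<in> sobolev2 k S) \<and>
     (\<exists>s. (\<forall>m. simple_function (lebesgue_on {0<..<T}) (s m) \<and>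
               (\<forall>t\<in>{0<..<T}. s m t \<in> sobolev2 k S)) \<and>
          (AE t in lebesgue_on {0<..<T}.
             (\<lambda>m::nat. sobolev2_norm k S (\<lambda>x. s m t x - w t x)) \<longlonglongrightarrow> 0)) \<and>
     integrable (lebesgue_on {0<..<T}) (\<lambda>t. (sobolev2_norm k S (w t))\<^sup>2)}"

end

theory Submission
  imports Defs
begin

text \<open>The proof is Li and Yau's local maximum principle argument. Put \<open>f = ln u\<close> and, for \<open>\<alpha> > 1\<close>,
  \<open>Q = |Df|\<^sup>2 - \<alpha> \<partial>\<^sub>t f\<close>; Bochner's formula gives \<open>(\<Delta> - \<partial>\<^sub>t) Q + 2 Df \<bullet> DQ = 2 |D\<^sup>2 f|\<^sup>2 \<ge> (2 / n) (\<Delta>f)\<^sup>2\<close>.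
  Maximise \<open>(t - s) \<zeta>\<^sup>2 Q\<close> with \<open>\<zeta>(x) = 1 - |x - p|\<^sup>2 / R\<^sup>2\<close> centred at a point \<open>p \<in> \<Omega>\<close>. A positive
  maximum is not attained on \<open>\<partial>\<Omega>\<close>: there \<open>\<partial>\<^sub>\<nu> Q \<le> 0\<close> by convexity and the Neumann condition, while
  \<open>\<partial>\<^sub>\<nu> \<zeta> < 0\<close> strictly because \<open>p\<close> is interior, so no Hopf lemma is needed. At an interior maximum the
  differential inequality bounds \<open>Q\<close>. Then \<open>R \<rightarrow> \<infinity>\<close>, \<open>\<alpha> \<rightarrow> 1\<close>, \<open>s \<rightarrow> 0\<close>. Positivity up to the boundary
  is arranged by working with \<open>u + \<epsilon>\<close> and letting \<open>\<epsilon> \<rightarrow> 0\<close> at the end.\<close>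

subsection \<open>Partial derivatives up to the boundary\<close>

text \<open>Two obstacles shape the argument. The smoothness hypothesis extends each iterated
  partial derivative separately and continuously to the lateral boundary; that the extensions are
  derivatives of one another there has to be proved. Convexity yields it, by the mean value
  inequality along segments. The solution is therefore carried as a jet, a family of functions
  indexed by lists of directions, and Q becomes differentiable within the closed domain, so that a
  boundary maximum has a one-sided derivative to contradict.

  The domain may also be unbounded, so the cutoff has to force a maximum. There the drift 2 Df . DQ
  becomes a term of size |Df| |D\<zeta>| Q / \<zeta>, which nothing absorbs when \<alpha> = 1. For
  \<alpha> > 1, -\<Delta>f = (Q + (\<alpha> - 1) |Df|^2) / \<alpha>, and its square contains a
  positive multiple of (\<alpha> - 1) |Df|^2 Q. Young's inequality absorbs the drift into it, at the
  price of a constant of order 1 / (\<alpha> - 1) in the coefficient of 1 / R^2. Starting at s > 0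
  keeps [s, \<tau>] inside (0, T), where the jet lives.\<close>

lemma has_derivative_pderivs:
  fixes f :: "'a::euclidean_space \<Rightarrow> real"
  assumes "smooth_on S f" "x \<in> S" "bs \<in> lists Basis"
  shows "(pderivs bs f has_derivative (\<lambda>h. \<Sum>b\<in>Basis. (h \<bullet> b) * pderivs (b # bs) f x)) (at x)"
proof -
  let ?D = "frechet_derivative (pderivs bs f) (at x)"
  have d: "(pderivs bs f has_derivative ?D) (at x)"
    using assms unfolding smooth_on_def frechet_derivative_works by blast
  have lin: "linear ?D" using d by (rule has_derivative_linear)
  have "?D h = (\<Sum>b\<in>Basis. (h \<bullet> b) * pderivs (b # bs) f x)" for h
  proof -
    have "?D h = ?D (\<Sum>b\<in>Basis. (h \<bullet> b) *\<^sub>R b)" by (simp add: euclidean_representation)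
    also have "\<dots> = (\<Sum>b\<in>Basis. (h \<bullet> b) * ?D b)"
      by (subst linear_sum[OF lin]) (simp only: linear_scale[OF lin] real_scaleR_def)
    finally show ?thesis by simp
  qed
  then have "?D = (\<lambda>h. \<Sum>b\<in>Basis. (h \<bullet> b) * pderivs (b # bs) f x)" by (rule ext)
  then show ?thesis by (rule has_derivative_eq_rhs[OF d])
qed

lemma continuous_on_pderivs:
  assumes "smooth_on S f" "bs \<in> lists Basis"
  shows "continuous_on S (pderivs bs f)"
  using assms unfolding smooth_on_def
  by (meson continuous_at_imp_continuous_on differentiable_imp_continuous_within)

section \<open>Symmetry of mixed partial derivatives\<close>

lemma second_difference_mvt:
  fixes f :: "'a::real_normed_vector \<Rightarrow> real"
  assumes "h > 0"
    and f': "\<And>s r. \<lbrakk>0 \<le> s; s \<le> h; 0 \<le> r; r \<le> h\<rbrakk> \<Longrightarrow>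
              (f has_derivative f' (z + s *\<^sub>R a + r *\<^sub>R b)) (at (z + s *\<^sub>R a + r *\<^sub>R b))"
    and f'': "\<And>s r. \<lbrakk>0 \<le> s; s \<le> h; 0 \<le> r; r \<le> h\<rbrakk> \<Longrightarrow>
              ((\<lambda>x. f' x a) has_derivative f'' (z + s *\<^sub>R a + r *\<^sub>R b)) (at (z + s *\<^sub>R a + r *\<^sub>R b))"
  shows "\<exists>s r. 0 < s \<and> s < h \<and> 0 < r \<and> r < h \<and>
     f (z + h *\<^sub>R a + h *\<^sub>R b) - f (z + h *\<^sub>R a) - f (z + h *\<^sub>R b) + f z
       = h\<^sup>2 * f'' (z + s *\<^sub>R a + r *\<^sub>R b) b"
proof -
  have d1: "((\<lambda>s. f (z + s *\<^sub>R a + r *\<^sub>R b)) has_real_derivative f' (z + s *\<^sub>R a + r *\<^sub>R b) a) (at s)"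
    if "0 \<le> s" "s \<le> h" "0 \<le> r" "r \<le> h" for s r
  proof -
    have "((\<lambda>s. f (z + s *\<^sub>R a + r *\<^sub>R b)) has_derivative
        (\<lambda>k. f' (z + s *\<^sub>R a + r *\<^sub>R b) (k *\<^sub>R a))) (at s)"
      by (rule has_derivative_compose[where g = "f" and f = "\<lambda>s. z + s *\<^sub>R a + r *\<^sub>R b", OF _ f'[OF that]])
         (auto intro!: derivative_eq_intros)
    moreover have "f' (z + s *\<^sub>R a + r *\<^sub>R b) (k *\<^sub>R a) = f' (z + s *\<^sub>R a + r *\<^sub>R b) a * k" for k
      using has_derivative_linear[OF f'[OF that]] by (simp add: linear_scale)
    ultimately show ?thesis by (simp add: has_field_derivative_def)
  qed
  have d2: "((\<lambda>r. f' (z + s *\<^sub>R a + r *\<^sub>R b) a) has_real_derivative f'' (z + s *\<^sub>R a + r *\<^sub>R b) b) (at r)"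
    if "0 \<le> s" "s \<le> h" "0 \<le> r" "r \<le> h" for s r
  proof -
    have "((\<lambda>r. f' (z + s *\<^sub>R a + r *\<^sub>R b) a) has_derivative
        (\<lambda>k. f'' (z + s *\<^sub>R a + r *\<^sub>R b) (k *\<^sub>R b))) (at r)"
      by (rule has_derivative_compose[where g = "(\<lambda>x. f' x a)" and f = "\<lambda>r. z + s *\<^sub>R a + r *\<^sub>R b", OF _ f''[OF that]])
         (auto intro!: derivative_eq_intros)
    moreover have "f'' (z + s *\<^sub>R a + r *\<^sub>R b) (k *\<^sub>R b) = f'' (z + s *\<^sub>R a + r *\<^sub>R b) b * k" for k
      using has_derivative_linear[OF f''[OF that]] by (simp add: linear_scale)
    ultimately show ?thesis by (simp add: has_field_derivative_def)
  qed
  \<comment> \<open>Mean value theorem along \<open>a\<close> for the increment of \<open>f\<close>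
    in direction \<open>b\<close>; the second application below runs along \<open>b\<close>.\<close>
  have "\<exists>s. 0 < s \<and> s < h \<and>
      (f (z + h *\<^sub>R a + h *\<^sub>R b) - f (z + h *\<^sub>R a + 0 *\<^sub>R b)) - (f (z + 0 *\<^sub>R a + h *\<^sub>R b) - f (z + 0 *\<^sub>R a + 0 *\<^sub>R b))
      = (h - 0) * (f' (z + s *\<^sub>R a + h *\<^sub>R b) a - f' (z + s *\<^sub>R a + 0 *\<^sub>R b) a)"
    by (rule MVT2[OF \<open>0 < h\<close>]) (auto intro!: DERIV_diff d1 simp del: scaleR_zero_left add_0_right)
  then obtain s where s: "0 < s" "s < h"
    "f (z + h *\<^sub>R a + h *\<^sub>R b) - f (z + h *\<^sub>R a) - (f (z + h *\<^sub>R b) - f z)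
      = h * (f' (z + s *\<^sub>R a + h *\<^sub>R b) a - f' (z + s *\<^sub>R a + 0 *\<^sub>R b) a)" by auto
  have "\<exists>r. 0 < r \<and> r < h \<and> f' (z + s *\<^sub>R a + h *\<^sub>R b) a - f' (z + s *\<^sub>R a + 0 *\<^sub>R b) a
      = (h - 0) * f'' (z + s *\<^sub>R a + r *\<^sub>R b) b"
    by (rule MVT2[OF \<open>0 < h\<close>]) (use s d2 in auto)
  then obtain r where "0 < r" "r < h" "f' (z + s *\<^sub>R a + h *\<^sub>R b) a - f' (z + s *\<^sub>R a + 0 *\<^sub>R b) a
      = h * f'' (z + s *\<^sub>R a + r *\<^sub>R b) b" by auto
  with s show ?thesis
    by (intro exI[of _ s] exI[of _ r]) (simp add: power2_eq_square algebra_simps)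
qed

text \<open>The second difference is symmetric in the two directions, so both mixed derivatives
  attain a common value, at possibly different points, in every small ball about x. Their continuity
  at x then forces equality.\<close>

lemma pderivs_commute:
  fixes f :: "'a::euclidean_space \<Rightarrow> real"
  assumes "open S" "smooth_on S f" "x \<in> S" "bs \<in> lists Basis" "a \<in> Basis" "b \<in> Basis"
  shows "pderivs (a # b # bs) f x = pderivs (b # a # bs) f x"
proof -
  let ?F = "pderivs bs f"
  have key: "\<exists>\<xi>\<in>ball x e. \<exists>\<eta>\<in>ball x e. pderivs (a # b # bs) f \<xi> = pderivs (b # a # bs) f \<eta>"
    if e: "0 < e" "ball x e \<subseteq> S" for e
  proof -
    define h where "h = e / 3"
    have h: "0 < h" using e by (simp add: h_def)
    have inball: "x + s *\<^sub>R c + r *\<^sub>R d \<in> ball x e" if "0 \<le> s" "s \<le> h" "0 \<le> r" "r \<le> h" "c \<in> Basis" "d \<in> Basis" for s r c d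
    proof -
      have "norm (s *\<^sub>R c + r *\<^sub>R d) \<le> norm (s *\<^sub>R c) + norm (r *\<^sub>R d)" by (rule norm_triangle_ineq)
      also have "\<dots> = s + r" using that by simp
      also have "\<dots> < e" using that e by (simp add: h_def)
      finally show ?thesis using norm_minus_cancel[of "s *\<^sub>R c + r *\<^sub>R d"] by (simp add: dist_norm)
    qed
    have A: "\<exists>s r. 0 < s \<and> s < h \<and> 0 < r \<and> r < h \<and>
     ?F (x + h *\<^sub>R c + h *\<^sub>R d) - ?F (x + h *\<^sub>R c) - ?F (x + h *\<^sub>R d) + ?F x
       = h\<^sup>2 * pderivs (d # c # bs) f (x + s *\<^sub>R c + r *\<^sub>R d)" if cd: "c \<in> Basis" "d \<in> Basis" for c d
    proof -
      have "(pderivs (c # bs) f has_derivative frechet_derivative (pderivs (c # bs) f) (at y)) (at y)"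
        if "y \<in> S" for y
        using assms(2,4) cd(1) that unfolding smooth_on_def frechet_derivative_works
        by (meson lists.Cons)
      then have "((\<lambda>y. frechet_derivative ?F (at y) c) has_derivative frechet_derivative (pderivs (c # bs) f) (at y)) (at y)"
        if "y \<in> S" for y
        using that by simp
      moreover have "(?F has_derivative frechet_derivative ?F (at y)) (at y)" if "y \<in> S" for y
        using assms that unfolding smooth_on_def frechet_derivative_works by auto
      ultimately show ?thesis
        using second_difference_mvt[of h ?F "\<lambda>y. frechet_derivative ?F (at y)" x c d
            "\<lambda>y. frechet_derivative (pderivs (c # bs) f) (at y)"] h inball cd e by (auto simp: subset_eq)
    qed
    obtain s r where 1: "0 < s" "s < h" "0 < r" "r < h"
     "?F (x + h *\<^sub>R a + h *\<^sub>R b) - ?F (x + h *\<^sub>R a) - ?F (x + h *\<^sub>R b) + ?F x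
       = h\<^sup>2 * pderivs (b # a # bs) f (x + s *\<^sub>R a + r *\<^sub>R b)" using A[OF assms(5,6)] by blast
    obtain s' r' where 2: "0 < s'" "s' < h" "0 < r'" "r' < h"
     "?F (x + h *\<^sub>R b + h *\<^sub>R a) - ?F (x + h *\<^sub>R b) - ?F (x + h *\<^sub>R a) + ?F x
       = h\<^sup>2 * pderivs (a # b # bs) f (x + s' *\<^sub>R b + r' *\<^sub>R a)" using A[OF assms(6,5)] by blast
    have "x + h *\<^sub>R b + h *\<^sub>R a = x + h *\<^sub>R a + h *\<^sub>R b" by simp
    with 1(5) 2(5) have "h\<^sup>2 * pderivs (b # a # bs) f (x + s *\<^sub>R a + r *\<^sub>R b) = h\<^sup>2 * pderivs (a # b # bs) f (x + s' *\<^sub>R b + r' *\<^sub>R a)"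
      by (simp only:)
    then have "pderivs (b # a # bs) f (x + s *\<^sub>R a + r *\<^sub>R b) = pderivs (a # b # bs) f (x + s' *\<^sub>R b + r' *\<^sub>R a)"
      using h by simp
    moreover have "x + s *\<^sub>R a + r *\<^sub>R b \<in> ball x e" "x + s' *\<^sub>R b + r' *\<^sub>R a \<in> ball x e"
      using 1 2 assms(5,6) by (intro inball; simp)+
    ultimately show ?thesis by metis
  qed
  have cont: "isCont (pderivs (c # d # bs) f) x" if "c \<in> Basis" "d \<in> Basis" for c d
    using that continuous_on_pderivs[OF assms(2), of "c # d # bs"] assms continuous_on_eq_continuous_at by auto
  obtain e0 where e0: "0 < e0" "ball x e0 \<subseteq> S" using assms open_contains_ball by blast
  have "\<bar>pderivs (a # b # bs) f x - pderivs (b # a # bs) f x\<bar> < \<epsilon>" if eps: "0 < \<epsilon>" for \<epsilon>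
  proof -
    obtain e1 where e1: "0 < e1" "\<And>y. dist y x < e1 \<Longrightarrow> \<bar>pderivs (a # b # bs) f y - pderivs (a # b # bs) f x\<bar> < \<epsilon>/2"
      using cont[OF assms(5,6)] half_gt_zero[OF eps] unfolding continuous_within_eps_delta dist_real_def by blast
    obtain e2 where e2: "0 < e2" "\<And>y. dist y x < e2 \<Longrightarrow> \<bar>pderivs (b # a # bs) f y - pderivs (b # a # bs) f x\<bar> < \<epsilon>/2"
      using cont[OF assms(6,5)] half_gt_zero[OF eps] unfolding continuous_within_eps_delta dist_real_def by blast
    have "0 < min e0 (min e1 e2)" "ball x (min e0 (min e1 e2)) \<subseteq> S" using e0 e1 e2 by auto
    from key[OF this] obtain \<xi> \<eta> where "\<xi> \<in> ball x (min e0 (min e1 e2))" "\<eta> \<in> ball x (min e0 (min e1 e2))"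
      "pderivs (a # b # bs) f \<xi> = pderivs (b # a # bs) f \<eta>" by blast
    moreover from this have "dist \<xi> x < e1" "dist \<eta> x < e2" by (auto simp: dist_commute)
    ultimately show ?thesis using e1(2)[of \<xi>] e2(2)[of \<eta>] by linarith
  qed
  from this[of "\<bar>pderivs (a # b # bs) f x - pderivs (b # a # bs) f x\<bar>"] show ?thesis by fastforce
qed

text \<open>Near z the partial derivatives are close to their values at z, so on the convex set
  \<open>S \<inter> ball z \<delta>\<close> the function g - L has a small Lipschitz constant. That
  estimate involves two free points and survives passage to the closure in both, so the base point z
  may itself lie on the boundary.\<close>

lemma has_derivative_within_closure:
  fixes g :: "'a::euclidean_space \<Rightarrow> real"
  assumes S: "convex S" and SX: "S \<subseteq> X" "X \<subseteq> closure S"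
    and cg: "continuous_on X g" and cd: "\<And>b. b \<in> Basis \<Longrightarrow> continuous_on X (d b)"
    and der: "\<And>y. y \<in> S \<Longrightarrow> (g has_derivative (\<lambda>h. \<Sum>b\<in>Basis. (h \<bullet> b) * d b y)) (at y within S)"
    and z: "z \<in> X"
  shows "(g has_derivative (\<lambda>h. \<Sum>b\<in>Basis. (h \<bullet> b) * d b z)) (at z within X)"
proof -
  define L where "L = (\<lambda>h. \<Sum>b\<in>Basis. (h \<bullet> b) * d b z)"
  have blL: "bounded_linear L" unfolding L_def
    by (intro bounded_linear_sum bounded_linear_mult_const bounded_linear_inner_left)
  have "\<exists>\<delta>>0. \<forall>y\<in>X. norm (y - z) < \<delta> \<longrightarrow> norm (g y - g z - L (y - z)) \<le> e * norm (y - z)"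
    if e: "e > 0" for e
  proof -
    \<comment> \<open>Each of the DIM('a) coordinates contributes at most \<open>e'\<close> times
      the norm of h to the operator norm.\<close>
    define e' where "e' = e / DIM('a)"
    have e': "e' > 0" using e by (simp add: e'_def)
    have "\<forall>b\<in>Basis. \<exists>\<delta>>0. \<forall>y\<in>X. dist y z < \<delta> \<longrightarrow> \<bar>d b y - d b z\<bar> \<le> e'"
      using cd z e' unfolding continuous_on_iff by (metis dist_real_def less_imp_le)
    then obtain \<delta>b where \<delta>b: "\<And>b. b \<in> Basis \<Longrightarrow> \<delta>b b > 0"
      "\<And>b y. b \<in> Basis \<Longrightarrow> y \<in> X \<Longrightarrow> dist y z < \<delta>b b \<Longrightarrow> \<bar>d b y - d b z\<bar> \<le> e'" by metis
    define \<delta> where "\<delta> = Min (\<delta>b ` Basis)"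
    have \<delta>: "\<delta> > 0" "\<And>b y. b \<in> Basis \<Longrightarrow> y \<in> X \<Longrightarrow> dist y z < \<delta> \<Longrightarrow> \<bar>d b y - d b z\<bar> \<le> e'"
      using \<delta>b by (auto simp: \<delta>_def)
    let ?B = "S \<inter> ball z \<delta>"
    have bound: "norm ((g y - L y) - (g y' - L y')) \<le> e * norm (y - y')" if "y \<in> ?B" "y' \<in> ?B" for y y'
    proof (rule differentiable_bound[of ?B "\<lambda>y. g y - L y" "\<lambda>y h. (\<Sum>b\<in>Basis. (h \<bullet> b) * d b y) - L h"])
      show "convex ?B" using S by (simp add: convex_Int)
      show "((\<lambda>y. g y - L y) has_derivative (\<lambda>h. (\<Sum>b\<in>Basis. (h \<bullet> b) * d b w) - L h)) (at w within ?B)" if "w \<in> ?B" for w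
        using that der[of w] by (intro has_derivative_diff bounded_linear_imp_has_derivative blL)
           (auto intro: has_derivative_subset)
      show "onorm (\<lambda>h. (\<Sum>b\<in>Basis. (h \<bullet> b) * d b w) - L h) \<le> e" if w: "w \<in> ?B" for w
      proof (rule onorm_le)
        fix h :: 'a
        have "(\<Sum>b\<in>Basis. (h \<bullet> b) * d b w) - L h = (\<Sum>b\<in>Basis. (h \<bullet> b) * (d b w - d b z))"
          by (simp add: L_def sum_subtractf right_diff_distrib)
        also have "norm \<dots> \<le> (\<Sum>b\<in>(Basis :: 'a set). norm h * e')"
        proof (intro sum_norm_le)
          fix b :: 'a assume b: "b \<in> Basis"
          have "dist w z < \<delta>" "w \<in> X" using w SX by (auto simp: dist_commute)
          with \<delta>(2)[OF b] have "\<bar>d b w - d b z\<bar> \<le> e'" by blast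
          then show "norm ((h \<bullet> b) * (d b w - d b z)) \<le> norm h * e'"
            using Basis_le_norm[OF b, of h] by (simp add: abs_mult mult_mono)
        qed
        also have "\<dots> = e * norm h" by (simp add: e'_def)
        finally show "norm ((\<Sum>b\<in>Basis. (h \<bullet> b) * d b w) - L h) \<le> e * norm h" .
      qed
    qed (use that in auto)
    have cgL: "continuous_on X (\<lambda>y. g y - L y)"
      by (intro continuous_intros cg linear_continuous_on blL)
    have approx: "\<exists>s. (\<forall>n. s n \<in> ?B) \<and> s \<longlonglongrightarrow> y" if "y \<in> X" "norm (y - z) < \<delta>" for y
    proof -
      have "y \<in> closure S \<inter> ball z \<delta>" using that SX by (auto simp: dist_norm norm_minus_commute)
      then have "y \<in> closure ?B" using open_Int_closure_subset[of "ball z \<delta>" S] by (auto simp: Int_commute)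
      then show ?thesis unfolding closure_sequential by simp
    qed
    have "norm (g y - g z - L (y - z)) \<le> e * norm (y - z)" if y: "y \<in> X" "norm (y - z) < \<delta>" for y
    proof -
      obtain s where s: "\<And>n. s n \<in> ?B" "s \<longlonglongrightarrow> y" using approx[OF y] by blast
      obtain r where r: "\<And>n. r n \<in> ?B" "r \<longlonglongrightarrow> z" using approx[OF z] \<delta> by auto
      have "(\<lambda>n. norm ((g (s n) - L (s n)) - (g (r n) - L (r n)))) \<longlonglongrightarrow> norm ((g y - L y) - (g z - L z))"
        using s r SX y z
        by (intro tendsto_norm tendsto_diff[of "\<lambda>n. g (s n) - L (s n)"]
            continuous_on_tendsto_compose[OF cgL] always_eventually) auto
      moreover have "(\<lambda>n. e * norm (s n - r n)) \<longlonglongrightarrow> e * norm (y - z)"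
        by (intro tendsto_intros s r)
      ultimately have "norm ((g y - L y) - (g z - L z)) \<le> e * norm (y - z)"
        by (rule LIMSEQ_le) (use bound s r in blast)
      moreover have "L (y - z) = L y - L z" using blL by (simp add: linear_diff bounded_linear.linear)
      ultimately show ?thesis by (simp add: algebra_simps)
    qed
    with \<delta>(1) show ?thesis by blast
  qed
  with blL show ?thesis unfolding has_derivative_within_alt L_def by blast
qed

subsection \<open>The inequality at a maximum\<close>

text \<open>Only differentiability of f' at 0 is available, so no Taylor formula: if l were
  positive, f' would be positive just to the right of 0 and f would increase there.\<close>

lemma second_derivative_local_max:
  fixes f :: "real \<Rightarrow> real"
  assumes "d > 0" and f': "\<And>x. \<bar>x\<bar> < d \<Longrightarrow> (f has_real_derivative f' x) (at x)"
    and f'': "(f' has_real_derivative l) (at 0)"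
    and max: "\<And>x. \<bar>x\<bar> < d \<Longrightarrow> f x \<le> f 0"
  shows "f' 0 = 0" and "l \<le> 0"
proof -
  show 0: "f' 0 = 0"
    using DERIV_local_max[OF f'[of 0] \<open>d > 0\<close>] max \<open>d > 0\<close> by auto
  show "l \<le> 0"
  proof (rule ccontr)
    assume "\<not> l \<le> 0"
    then obtain e where e: "e > 0" "\<And>h. 0 < h \<Longrightarrow> h < e \<Longrightarrow> f' 0 < f' (0 + h)"
      using DERIV_pos_inc_right[OF f''] by auto
    define h where "h = min e d / 2"
    have h: "0 < h" "h < e" "h < d" using e \<open>d > 0\<close> by (auto simp: h_def)
    have "\<exists>z. 0 < z \<and> z < h \<and> f h - f 0 = (h - 0) * f' z"
      by (rule MVT2) (use h f' in auto)
    then obtain z where z: "0 < z" "z < h" "f h - f 0 = h * f' z" by auto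
    moreover have "f' z > 0" using e(2)[of z] z h 0 by auto
    ultimately have "f h > f 0" using h by (metis diff_gt_0_iff_gt mult_pos_pos)
    with max[of h] h show False by auto
  qed
qed

text \<open>The variables are values at a maximum of the localised Q: \<open>z\<close> is the
  gradient of the cutoff, \<open>q1\<close>, \<open>q2\<close>, \<open>qt\<close> are derivatives of
  Q, \<open>ft\<close> is the time derivative of f, \<open>H\<close> is |D^2 f|^2 and \<sigma> is
  the elapsed time. Bochner's formula times \<zeta>^2 bounds \<open>H\<close> above by a multiple of
  Q, the trace inequality bounds it below by a multiple of Q, and cancelling one factor Q leaves a
  linear bound. In the constant, 24 is 6 times the 4 of \<open>z\<close>, 4n comes from the Hessian
  of the cutoff, and the last term is 16 / a.\<close>

lemma li_yau_max_algebra: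
  fixes f z q1 q2 :: "'i \<Rightarrow> real" and \<zeta> Q \<alpha> \<sigma> R qt H ft :: real
  assumes fin: "finite I" "I \<noteq> {}" and pos: "0 < \<zeta>" "\<zeta> \<le> 1" "0 < Q" "1 < \<alpha>" "0 < \<sigma>" "0 < R"
    and q1: "\<And>i. i \<in> I \<Longrightarrow> \<zeta> * q1 i = - 2 * z i * Q"
    and q2: "\<And>i. i \<in> I \<Longrightarrow> \<zeta>\<^sup>2 * q2 i \<le> (6 * (z i)\<^sup>2 + 4 * \<zeta> / R\<^sup>2) * Q"
    and qt: "- Q \<le> \<sigma> * qt"
    and bochner: "(\<Sum>i\<in>I. q2 i) = qt - 2 * (\<Sum>i\<in>I. f i * q1 i) + 2 * H"
    and H: "(ft - (\<Sum>i\<in>I. (f i)\<^sup>2))\<^sup>2 \<le> real (card I) * H"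
    and Q: "Q = (\<Sum>i\<in>I. (f i)\<^sup>2) - \<alpha> * ft"
    and z: "(\<Sum>i\<in>I. (z i)\<^sup>2) \<le> 4 / R\<^sup>2"
  shows "\<sigma> * \<zeta>\<^sup>2 * Q \<le> real (card I) * \<alpha>\<^sup>2 / 2 *
      (1 + \<sigma> * (24 + 4 * real (card I) + 4 * real (card I) * \<alpha>\<^sup>2 / (\<alpha> - 1)) / R\<^sup>2)"
proof -
  define n where "n = real (card I)"
  have n: "n \<ge> 1" using fin by (simp add: n_def Suc_leI card_gt_0_iff)
  define P where "P = (\<Sum>i\<in>I. (f i)\<^sup>2)"
  have P: "P \<ge> 0" by (simp add: P_def sum_nonneg)
  \<comment> \<open>The weight for Young's inequality in \<open>drift\<close>. It makes the gradient
    term created there equal to the one supplied by \<open>hess\<close>, so that P drops out at the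
    end.\<close>
  define a where "a = 4 * (\<alpha> - 1) / (n * \<alpha>\<^sup>2)"
  have a: "a > 0" using pos n by (simp add: a_def)
  have lap: "\<zeta>\<^sup>2 * (\<Sum>i\<in>I. q2 i) \<le> Q * ((24 + 4 * n) / R\<^sup>2)"
  proof -
    have "\<zeta>\<^sup>2 * (\<Sum>i\<in>I. q2 i) \<le> (\<Sum>i\<in>I. (6 * (z i)\<^sup>2 + 4 * \<zeta> / R\<^sup>2) * Q)"
      unfolding sum_distrib_left by (intro sum_mono q2)
    also have "\<dots> = Q * (6 * (\<Sum>i\<in>I. (z i)\<^sup>2) + 4 * n * \<zeta> / R\<^sup>2)"
      by (simp add: sum_distrib_right[symmetric] sum.distrib sum_distrib_left[symmetric] n_def)
    also have "\<dots> \<le> Q * (6 * (4 / R\<^sup>2) + 4 * n * 1 / R\<^sup>2)"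
      using pos z n by (intro mult_left_mono add_mono divide_right_mono) auto
    also have "\<dots> = Q * ((24 + 4 * n) / R\<^sup>2)" by (simp add: add_divide_distrib)
    finally show ?thesis .
  qed
  have time: "- \<zeta>\<^sup>2 * qt \<le> Q * (\<zeta>\<^sup>2 / \<sigma>)"
  proof -
    have "- qt \<le> Q / \<sigma>" using qt pos by (simp add: field_simps)
    from mult_left_mono[OF this, of "\<zeta>\<^sup>2"] show ?thesis by (simp add: mult_ac)
  qed
  have drift: "2 * \<zeta>\<^sup>2 * (\<Sum>i\<in>I. f i * q1 i) \<le> Q * (a * \<zeta>\<^sup>2 * P + 16 / a / R\<^sup>2)"
  proof -
    have "2 * \<zeta>\<^sup>2 * (\<Sum>i\<in>I. f i * q1 i) = (\<Sum>i\<in>I. 2 * \<zeta> * f i * (\<zeta> * q1 i))"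
      by (simp add: sum_distrib_left power2_eq_square mult_ac)
    also have "\<dots> = (\<Sum>i\<in>I. Q * (- 4 * \<zeta> * f i * z i))"
      by (intro sum.cong) (auto simp: q1)
    also have "\<dots> \<le> (\<Sum>i\<in>I. Q * (a * \<zeta>\<^sup>2 * (f i)\<^sup>2 + 4 / a * (z i)\<^sup>2))"
    proof (intro sum_mono mult_left_mono)
      fix i
      have "0 \<le> (a * \<zeta> * f i + 2 * z i)\<^sup>2 / a" using a by simp
      also have "\<dots> = a * \<zeta>\<^sup>2 * (f i)\<^sup>2 + 4 / a * (z i)\<^sup>2 + 4 * \<zeta> * f i * z i"
        using a by (simp add: power2_eq_square field_simps)
      finally show "- 4 * \<zeta> * f i * z i \<le> a * \<zeta>\<^sup>2 * (f i)\<^sup>2 + 4 / a * (z i)\<^sup>2" by simp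
    qed (use pos in auto)
    also have "\<dots> = Q * (a * \<zeta>\<^sup>2 * P + 4 / a * (\<Sum>i\<in>I. (z i)\<^sup>2))"
      by (simp add: sum_distrib_left[symmetric] sum_divide_distrib[symmetric] sum.distrib P_def)
    also have "\<dots> \<le> Q * (a * \<zeta>\<^sup>2 * P + 4 / a * (4 / R\<^sup>2))"
      using pos z a by (intro mult_left_mono add_left_mono) auto
    finally show ?thesis by simp
  qed
  have "(Q + (\<alpha> - 1) * P)\<^sup>2 = \<alpha>\<^sup>2 * (ft - P)\<^sup>2"
    unfolding Q P_def[symmetric] by (simp add: power2_eq_square algebra_simps)
  also have "\<dots> \<le> \<alpha>\<^sup>2 * (n * H)" using H by (intro mult_left_mono) (auto simp: n_def P_def)
  finally have "(Q + (\<alpha> - 1) * P)\<^sup>2 \<le> n * \<alpha>\<^sup>2 * H" by (simp add: mult_ac)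
  moreover have "(Q + (\<alpha> - 1) * P)\<^sup>2 = Q * (Q + 2 * (\<alpha> - 1) * P) + ((\<alpha> - 1) * P)\<^sup>2"
    by (simp add: power2_eq_square algebra_simps)
  moreover have "0 \<le> ((\<alpha> - 1) * P)\<^sup>2" by (rule zero_le_power2)
  \<comment> \<open>The discarded square has no factor Q; what is kept has one, which is needed for
    the cancellation below.\<close>
  ultimately have "Q * (Q + 2 * (\<alpha> - 1) * P) \<le> n * \<alpha>\<^sup>2 * H" by linarith
  then have hess: "Q * ((Q + 2 * (\<alpha> - 1) * P) / (n * \<alpha>\<^sup>2)) \<le> H"
    using n pos by (simp add: divide_le_eq mult_ac)
  have "Q * (2 * \<zeta>\<^sup>2 * ((Q + 2 * (\<alpha> - 1) * P) / (n * \<alpha>\<^sup>2))) \<le> 2 * \<zeta>\<^sup>2 * H"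
    using mult_left_mono[OF hess, of "2 * \<zeta>\<^sup>2"] by (simp add: mult_ac)
  also have "2 * \<zeta>\<^sup>2 * H = \<zeta>\<^sup>2 * (\<Sum>i\<in>I. q2 i) - \<zeta>\<^sup>2 * qt + 2 * \<zeta>\<^sup>2 * (\<Sum>i\<in>I. f i * q1 i)"
    unfolding bochner by (simp add: algebra_simps)
  also have "\<dots> \<le> Q * ((24 + 4 * n) / R\<^sup>2 + \<zeta>\<^sup>2 / \<sigma> + (a * \<zeta>\<^sup>2 * P + 16 / a / R\<^sup>2))"
    using lap time drift by (simp add: distrib_left)
  finally have "2 * \<zeta>\<^sup>2 * ((Q + 2 * (\<alpha> - 1) * P) / (n * \<alpha>\<^sup>2))
      \<le> (24 + 4 * n) / R\<^sup>2 + \<zeta>\<^sup>2 / \<sigma> + (a * \<zeta>\<^sup>2 * P + 16 / a / R\<^sup>2)"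
    using pos by (simp only: mult_le_cancel_left_pos)
  moreover have "2 * \<zeta>\<^sup>2 * ((Q + 2 * (\<alpha> - 1) * P) / (n * \<alpha>\<^sup>2)) = 2 * \<zeta>\<^sup>2 * Q / (n * \<alpha>\<^sup>2) + a * \<zeta>\<^sup>2 * P"
    by (simp add: a_def add_divide_distrib distrib_left mult_ac)
  moreover have "16 / a = 4 * n * \<alpha>\<^sup>2 / (\<alpha> - 1)"
    using pos n by (simp add: a_def field_simps)
  ultimately have "2 * \<zeta>\<^sup>2 * Q / (n * \<alpha>\<^sup>2) \<le> \<zeta>\<^sup>2 / \<sigma> + (24 + 4 * n + 4 * n * \<alpha>\<^sup>2 / (\<alpha> - 1)) / R\<^sup>2"
    by (simp add: add_divide_distrib)
  also have "\<zeta>\<^sup>2 / \<sigma> \<le> 1 / \<sigma>" using pos by (intro divide_right_mono) (auto simp: power_le_one)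
  finally have "2 * \<zeta>\<^sup>2 * Q / (n * \<alpha>\<^sup>2) \<le> 1 / \<sigma> + (24 + 4 * n + 4 * n * \<alpha>\<^sup>2 / (\<alpha> - 1)) / R\<^sup>2" by simp
  from mult_left_mono[OF this, of "\<sigma> * (n * \<alpha>\<^sup>2 / 2)"] pos n
  have "\<sigma> * \<zeta>\<^sup>2 * Q \<le> (\<sigma> * (n * \<alpha>\<^sup>2 / 2)) * (1 / \<sigma> + (24 + 4 * n + 4 * n * \<alpha>\<^sup>2 / (\<alpha> - 1)) / R\<^sup>2)"
    by (simp add: mult_ac)
  also have "\<dots> = n * \<alpha>\<^sup>2 / 2 * (\<sigma> * (1 / \<sigma>) + \<sigma> * ((24 + 4 * n + 4 * n * \<alpha>\<^sup>2 / (\<alpha> - 1)) / R\<^sup>2))"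
    by (simp only: distrib_left mult_ac)
  finally show ?thesis using pos by (simp add: n_def)
qed

text \<open>Cauchy-Schwarz on the diagonal entries, after which the off-diagonal squares are added
  for free.\<close>

lemma sum_power2_le_hessian:
  fixes h :: "'i \<Rightarrow> 'i \<Rightarrow> real"
  assumes "finite I"
  shows "(\<Sum>i\<in>I. h i i)\<^sup>2 \<le> real (card I) * (\<Sum>j\<in>I. \<Sum>i\<in>I. (h j i)\<^sup>2)"
proof -
  have "(\<Sum>i\<in>I. h i i)\<^sup>2 \<le> real (card I) * (\<Sum>i\<in>I. (h i i)\<^sup>2)"
    using sum_squared_le_sum_of_squares[of "\<lambda>i. h i i" I] assms by (cases "I = {}") (auto simp: card_gt_0_iff mult.commute)
  also have "\<dots> \<le> real (card I) * (\<Sum>j\<in>I. \<Sum>i\<in>I. (h j i)\<^sup>2)"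
    by (intro mult_left_mono sum_mono member_le_sum[of _ I "\<lambda>i. (h _ i)\<^sup>2"]) (use assms in auto)
  finally show ?thesis .
qed

subsection \<open>The logarithm of a solution in the interior\<close>

text \<open>The derivative within S is recorded by its coefficients in the standard basis, so that
  they can be read off from the jet and differentiated again. At boundary points the definition
  asserts nothing about uniqueness of \<open>d\<close>.\<close>

definition has_partials :: "'a::euclidean_space set \<Rightarrow> ('a \<Rightarrow> real) \<Rightarrow> ('a \<Rightarrow> real) \<Rightarrow> 'a \<Rightarrow> bool" where
  "has_partials S F d z \<longleftrightarrow> (F has_derivative (\<lambda>h. \<Sum>b\<in>Basis. (h \<bullet> b) * d b)) (at z within S)"

lemma sum_inner_Basis:
  fixes b :: "'a::euclidean_space" and d :: "'a \<Rightarrow> real"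
  assumes "b \<in> Basis"
  shows "(\<Sum>c\<in>Basis. (b \<bullet> c) * d c) = d b"
proof -
  have "(\<Sum>c\<in>Basis. (b \<bullet> c) * d c) = (\<Sum>c\<in>Basis. if b = c then d c else 0)"
    using assms by (intro sum.cong) (auto simp: inner_Basis)
  then show ?thesis using assms by simp
qed

lemma sum_inner_Basis_prod:
  fixes h :: "'a::euclidean_space" and k :: real
  shows "(\<Sum>b\<in>Basis. ((h, k) \<bullet> b) * F b) = (\<Sum>i\<in>Basis. (h \<bullet> i) * F (i, 0)) + k * F (0, 1)"
  unfolding Basis_prod_def by (subst sum.union_disjoint) (auto simp: sum.reindex inj_on_def)

lemma in_Basis_prod [simp]:
  "(0, 1) \<in> (Basis :: ('a::euclidean_space \<times> real) set)"
  "i \<in> Basis \<Longrightarrow> (i, 0) \<in> (Basis :: ('a::euclidean_space \<times> real) set)"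
  by (auto simp: Basis_prod_def)

lemma has_partials_mult:
  assumes "has_partials S F d z" "has_partials S G e z"
  shows "has_partials S (\<lambda>z. F z * G z) (\<lambda>b. d b * G z + F z * e b) z"
  unfolding has_partials_def
  by (rule has_derivative_eq_rhs[OF has_derivative_mult[OF assms[unfolded has_partials_def]]])
     (simp add: sum_distrib_left sum_distrib_right sum.distrib distrib_left mult_ac add.commute)

text \<open>The quotient rule is written in quotients by G because, with G = u, these are again the
  building blocks of the derivatives of ln u.\<close>

lemma has_partials_divide:
  assumes "has_partials S F d z" "has_partials S G e z" "G z \<noteq> 0"
  shows "has_partials S (\<lambda>z. F z / G z) (\<lambda>b. d b / G z - F z / G z * (e b / G z)) z"
proof -
  have eq: "((\<Sum>b\<in>Basis. h \<bullet> b * d b) * G z - F z * (\<Sum>b\<in>Basis. h \<bullet> b * e b)) / (G z * G z)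
      = (\<Sum>b\<in>Basis. h \<bullet> b * (d b / G z - F z / G z * (e b / G z)))" for h
  proof -
    have "(\<Sum>b\<in>Basis. h \<bullet> b * (d b / G z - F z / G z * (e b / G z)))
      = (\<Sum>b\<in>Basis. (h \<bullet> b * d b * G z - F z * (h \<bullet> b * e b)) / (G z * G z))"
      using assms(3) by (intro sum.cong) (auto simp: field_simps)
    then show ?thesis
      by (simp add: sum_divide_distrib[symmetric] sum_subtractf sum_distrib_left sum_distrib_right)
  qed
  show ?thesis unfolding has_partials_def
    by (rule has_derivative_eq_rhs[OF has_derivative_divide'[OF assms(1,2)[unfolded has_partials_def] assms(3)]])
       (simp only: eq)
qed

lemma has_partials_add:
  assumes "has_partials S F d z" "has_partials S G e z"
  shows "has_partials S (\<lambda>z. F z + G z) (\<lambda>b. d b + e b) z"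
  unfolding has_partials_def
  by (rule has_derivative_eq_rhs[OF has_derivative_add[OF assms[unfolded has_partials_def]]])
     (simp add: sum.distrib distrib_left)

lemma has_partials_diff:
  assumes "has_partials S F d z" "has_partials S G e z"
  shows "has_partials S (\<lambda>z. F z - G z) (\<lambda>b. d b - e b) z"
  unfolding has_partials_def
  by (rule has_derivative_eq_rhs[OF has_derivative_diff[OF assms[unfolded has_partials_def]]])
     (simp add: sum_subtractf right_diff_distrib)

lemma has_partials_cmult:
  assumes "has_partials S F d z"
  shows "has_partials S (\<lambda>z. c * F z) (\<lambda>b. c * d b) z"
  unfolding has_partials_def
  by (rule has_derivative_eq_rhs[OF has_derivative_mult_right[OF assms[unfolded has_partials_def]]])
     (simp add: sum_distrib_left mult_ac)

lemma has_partials_sum: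
  assumes "\<And>i. i \<in> I \<Longrightarrow> has_partials S (F i) (d i) z"
  shows "has_partials S (\<lambda>z. \<Sum>i\<in>I. F i z) (\<lambda>b. \<Sum>i\<in>I. d i b) z"
  unfolding has_partials_def
  by (rule has_derivative_eq_rhs[OF has_derivative_sum[OF assms[unfolded has_partials_def]]], assumption)
     (simp add: sum_distrib_left sum.swap[of _ I])

lemma has_partials_power2:
  assumes "has_partials S F d z"
  shows "has_partials S (\<lambda>z. (F z)\<^sup>2) (\<lambda>b. 2 * F z * d b) z"
proof -
  have "(\<lambda>b. d b * F z + F z * d b) = (\<lambda>b. 2 * F z * d b)" by auto
  with has_partials_mult[OF assms assms] show ?thesis by (simp add: power2_eq_square)
qed

text \<open>The device for differentiating an identity: an equation valid on S passes to the partial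
  derivatives at interior points, whichever formulas produced them.\<close>

lemma has_partials_unique:
  assumes "has_partials S F d z" "has_partials S G e z" "\<And>y. y \<in> S \<Longrightarrow> F y = G y"
    and "z \<in> interior S" "b \<in> Basis"
  shows "d b = e b"
proof -
  have z: "z \<in> S" using assms(4) interior_subset by auto
  have "(F has_derivative (\<lambda>h. \<Sum>b\<in>Basis. (h \<bullet> b) * e b)) (at z within S)"
    by (rule has_derivative_transform[OF z assms(3) assms(2)[unfolded has_partials_def]])
  then have "(\<lambda>h. \<Sum>b\<in>Basis. (h \<bullet> b) * d b) = (\<lambda>h. \<Sum>b\<in>Basis. (h \<bullet> b) * e b)"
    using assms(1,4) unfolding has_partials_def
    by (simp only: at_within_interior) (rule has_derivative_unique)
  from fun_cong[OF this, of b] show ?thesis by (simp only: sum_inner_Basis[OF assms(5)])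
qed

lemma has_partials_line:
  assumes "has_partials S F d (z + r *\<^sub>R b)" "z + r *\<^sub>R b \<in> interior S" "b \<in> Basis"
  shows "((\<lambda>r. F (z + r *\<^sub>R b)) has_real_derivative d b) (at r)"
proof -
  have line: "((\<lambda>r. z + r *\<^sub>R b) has_derivative (\<lambda>k. k *\<^sub>R b)) (at r)"
    by (auto intro!: derivative_eq_intros)
  have "(F has_derivative (\<lambda>h. \<Sum>b\<in>Basis. (h \<bullet> b) * d b)) (at (z + r *\<^sub>R b))"
    using assms(1) by (simp only: has_partials_def at_within_interior[OF assms(2)])
  then have "((\<lambda>r. F (z + r *\<^sub>R b)) has_derivative (\<lambda>k. \<Sum>c\<in>Basis. ((k *\<^sub>R b) \<bullet> c) * d c)) (at r)"
    by (rule has_derivative_compose[OF line])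
  moreover have "(\<Sum>c\<in>Basis. ((k *\<^sub>R b) \<bullet> c) * d c) = d b * k" for k
    by (simp add: mult.assoc sum_distrib_left[symmetric] sum_inner_Basis[OF assms(3)])
  ultimately show ?thesis by (simp add: has_field_derivative_def)
qed

text \<open>\<open>g bs\<close> stands for the iterated partial derivative \<open>\<partial>\<^sub>b\<^sub>s u\<close>, extended continuously to the lateral
  boundary; \<open>(0, 1)\<close> is the time direction and \<open>(i, 0)\<close> a spatial one.\<close>

locale neumann_heat_jet =
  fixes \<Omega> :: "'a::euclidean_space set" and T :: real
    and g :: "('a \<times> real) list \<Rightarrow> 'a \<times> real \<Rightarrow> real"
  assumes open_domain: "open \<Omega>" and convex_domain: "convex \<Omega>" and smooth_domain: "smooth_boundary \<Omega>"
    and jet: "\<lbrakk>bs \<in> lists Basis; z \<in> closure \<Omega> \<times> {0<..<T}\<rbrakk> \<Longrightarrow>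
      has_partials (closure \<Omega> \<times> {0<..<T}) (g bs) (\<lambda>b. g (b # bs) z) z"
    and commute: "\<lbrakk>a \<in> Basis; b \<in> Basis; bs \<in> lists Basis; z \<in> \<Omega> \<times> {0<..<T}\<rbrakk> \<Longrightarrow>
      g (a # b # bs) z = g (b # a # bs) z"
    and positive: "z \<in> closure \<Omega> \<times> {0<..<T} \<Longrightarrow> 0 < g [] z"
    and heat: "z \<in> closure \<Omega> \<times> {0<..<T} \<Longrightarrow> g [(0, 1)] z = (\<Sum>i\<in>Basis. g [(i, 0), (i, 0)] z)"
    and neumann: "\<lbrakk>x \<in> frontier \<Omega>; t \<in> {0<..<T}; x \<in> U; local_defining_function \<Omega> U \<phi>\<rbrakk> \<Longrightarrow>
      (\<Sum>i\<in>Basis. (grad \<phi> x \<bullet> i) * g [(i, 0)] (x, t)) = 0"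
begin

abbreviation "X \<equiv> closure \<Omega> \<times> {0<..<T}"

text \<open>First, second and third partial derivatives of \<open>ln u\<close>.\<close>

definition f1 where "f1 a z = g [a] z / g [] z"
definition f2 where "f2 a b z = g [b, a] z / g [] z - f1 a z * f1 b z"
definition f3 where "f3 a b c z = g [c, b, a] z / g [] z - f2 a b z * f1 c z - f2 a c z * f1 b z
   - f2 b c z * f1 a z - f1 a z * f1 b z * f1 c z"

text \<open>\<open>Q1\<close> and \<open>Q2\<close> are closed formulas for the derivatives of Q, so
  they make sense on the lateral boundary too, where Q is differentiable only from within.\<close>

definition Q where "Q \<alpha> z = (\<Sum>j\<in>Basis. (f1 (j, 0) z)\<^sup>2) - \<alpha> * f1 (0, 1) z"
definition Q1 where "Q1 \<alpha> b z = (\<Sum>j\<in>Basis. 2 * f1 (j, 0) z * f2 (j, 0) b z) - \<alpha> * f2 (0, 1) b z"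
definition Q2 where "Q2 \<alpha> b c z =
  (\<Sum>j\<in>Basis. 2 * f2 (j, 0) c z * f2 (j, 0) b z + 2 * f1 (j, 0) z * f3 (j, 0) b c z) - \<alpha> * f3 (0, 1) b c z"

lemma interior_X: "x \<in> \<Omega> \<Longrightarrow> t \<in> {0<..<T} \<Longrightarrow> (x, t) \<in> interior X"
  using open_domain closure_subset[of \<Omega>] by (intro interiorI[of "\<Omega> \<times> {0<..<T}"]) (auto intro: open_Times)

section \<open>Derivatives of ln u and Bochner's formula\<close>

lemma f1_partials:
  assumes "a \<in> Basis" "z \<in> X"
  shows "has_partials X (f1 a) (\<lambda>b. f2 a b z) z"
proof -
  have "g [] z \<noteq> 0" using positive[OF assms(2)] by simp
  from has_partials_divide[OF jet[of "[a]"] jet[of "[]"] this] assms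
  show ?thesis by (simp add: f1_def[abs_def] f2_def)
qed

lemma f2_partials:
  assumes "a \<in> Basis" "b \<in> Basis" "z \<in> X"
  shows "has_partials X (f2 a b) (\<lambda>c. f3 a b c z) z"
proof -
  have "g [] z \<noteq> 0" using positive[OF assms(3)] by simp
  from has_partials_diff[OF has_partials_divide[OF jet[of "[b, a]"] jet[of "[]"] this]
        has_partials_mult[OF f1_partials[OF assms(1,3)] f1_partials[OF assms(2,3)]]] assms
  have "has_partials X (f2 a b) (\<lambda>c. g [c, b, a] z / g [] z - g [b, a] z / g [] z * (g [c] z / g [] z)
     - (f2 a c z * f1 b z + f1 a z * f2 b c z)) z" by (simp add: f2_def[abs_def])
  moreover have "g [c, b, a] z / g [] z - g [b, a] z / g [] z * (g [c] z / g [] z)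
     - (f2 a c z * f1 b z + f1 a z * f2 b c z) = f3 a b c z" for c
  proof -
    \<comment> \<open>Eliminating u_ab / u in favour of f_ab + f_a f_b turns the outcome of the
      quotient rule into the symmetric expression that defines \<open>f3\<close>.\<close>
    have "g [b, a] z / g [] z = f2 a b z + f1 a z * f1 b z" by (simp add: f2_def)
    moreover have "g [c] z / g [] z = f1 c z" by (simp add: f1_def)
    ultimately show ?thesis unfolding f3_def by (simp only:) (simp add: algebra_simps)
  qed
  ultimately show ?thesis by simp
qed

lemma Q_partials:
  assumes "z \<in> X"
  shows "has_partials X (Q \<alpha>) (\<lambda>b. Q1 \<alpha> b z) z"
  unfolding Q_def[abs_def] Q1_def using assms
  by (intro has_partials_diff has_partials_sum has_partials_power2 has_partials_cmult f1_partials) auto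

lemma Q1_partials:
  assumes "z \<in> X" "b \<in> Basis"
  shows "has_partials X (Q1 \<alpha> b) (\<lambda>c. Q2 \<alpha> b c z) z"
proof -
  have "has_partials X (Q1 \<alpha> b) (\<lambda>c. (\<Sum>j\<in>Basis. (2 * f2 (j, 0) c z) * f2 (j, 0) b z + 2 * f1 (j, 0) z * f3 (j, 0) b c z)
    - \<alpha> * f3 (0, 1) b c z) z"
    unfolding Q1_def[abs_def] using assms
    by (intro has_partials_diff has_partials_sum has_partials_mult has_partials_cmult f1_partials f2_partials) auto
  then show ?thesis by (simp add: Q2_def)
qed

lemma f2_commute:
  assumes "a \<in> Basis" "b \<in> Basis" "z \<in> \<Omega> \<times> {0<..<T}"
  shows "f2 a b z = f2 b a z"
  using commute[of a b "[]" z] assms by (simp add: f2_def)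

text \<open>The locale swaps only the two outermost derivatives. The two innermost ones are swapped
  by differentiating the second-order symmetry, which holds on an open set.\<close>

lemma commute_inner:
  assumes "a \<in> Basis" "b \<in> Basis" "c \<in> Basis" "z \<in> \<Omega> \<times> {0<..<T}"
  shows "g [a, b, c] z = g [a, c, b] z"
proof -
  let ?Y = "\<Omega> \<times> {0<..<T}"
  have sub: "?Y \<subseteq> X" using closure_subset by auto
  have d: "has_partials ?Y (g [p, q]) (\<lambda>b. g [b, p, q] z) z" if "p \<in> Basis" "q \<in> Basis" for p q
    using jet[of "[p, q]" z] that assms(4) sub unfolding has_partials_def
    by (auto intro: has_derivative_subset)
  have "z \<in> interior ?Y" using assms(4) open_domain by (simp add: interior_open open_Times)
  from has_partials_unique[OF d d _ this assms(1), of b c c b] commute[of b c "[]"] assms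
  show ?thesis by auto
qed

text \<open>Summed over the spatial b, this exchanges the Laplacian with the derivative in direction
  a.\<close>

lemma f3_rotate:
  assumes "a \<in> Basis" "b \<in> Basis" "z \<in> \<Omega> \<times> {0<..<T}"
  shows "f3 a b b z = f3 b b a z"
proof -
  have "g [b, b, a] z = g [b, a, b] z" using commute_inner[of b b a z] assms by simp
  also have "\<dots> = g [a, b, b] z" using commute[of b a "[b]" z] assms by simp
  finally show ?thesis using f2_commute[OF assms] by (simp add: f3_def)
qed

lemma log_heat:
  assumes "z \<in> X"
  shows "f1 (0, 1) z = (\<Sum>i\<in>Basis. f2 (i, 0) (i, 0) z + (f1 (i, 0) z)\<^sup>2)"
  using heat[OF assms] by (simp add: f2_def f1_def power2_eq_square sum_divide_distrib)

lemma log_heat_partials: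
  assumes "z \<in> \<Omega> \<times> {0<..<T}" "e \<in> Basis"
  shows "f2 (0, 1) e z = (\<Sum>i\<in>Basis. f3 (i, 0) (i, 0) e z + 2 * f1 (i, 0) z * f2 (i, 0) e z)"
proof -
  have z: "z \<in> X" using assms(1) closure_subset by auto
  have zi: "z \<in> interior X" using assms(1) interior_X by auto
  have "has_partials X (\<lambda>z. \<Sum>i\<in>Basis. f2 (i, 0) (i, 0) z + (f1 (i, 0) z)\<^sup>2)
    (\<lambda>e. \<Sum>i\<in>Basis. f3 (i, 0) (i, 0) e z + 2 * f1 (i, 0) z * f2 (i, 0) e z) z"
    using z by (intro has_partials_sum has_partials_add has_partials_power2 f1_partials f2_partials) auto
  from has_partials_unique[OF f1_partials[OF _ z] this log_heat zi assms(2)]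
  show ?thesis by simp
qed

text \<open>In flat space \<Delta> commutes with all partial derivatives, so no curvature term
  appears. The differentiated equation f_t = \<Delta>f + |Df|^2 removes both sums of third
  derivatives, and the remaining products regroup into the time derivative of Q and the drift Df .
  DQ, leaving twice the squared Hessian.\<close>

lemma bochner:
  assumes "z \<in> \<Omega> \<times> {0<..<T}"
  shows "(\<Sum>i\<in>Basis. Q2 \<alpha> (i, 0) (i, 0) z) = Q1 \<alpha> (0, 1) z - 2 * (\<Sum>i\<in>Basis. f1 (i, 0) z * Q1 \<alpha> (i, 0) z)
    + 2 * (\<Sum>j\<in>Basis. \<Sum>i\<in>Basis. (f2 (j, 0) (i, 0) z)\<^sup>2)"
proof -
  let ?B = "Basis :: 'a set"
  let ?p = "\<lambda>j. f1 (j, 0) z" and ?h = "\<lambda>j i. f2 (j, 0) (i, 0) z" and ?w = "\<lambda>j. f2 (0, 1) (j, 0) z"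
  have rot: "f3 (j, 0) (i, 0) (i, 0) z = f3 (i, 0) (i, 0) (j, 0) z"
    "f3 (0, 1) (i, 0) (i, 0) z = f3 (i, 0) (i, 0) (0, 1) z" if "i \<in> ?B" "j \<in> ?B" for i j
    using f3_rotate assms that in_Basis_prod by blast+
  have sym: "f2 (j, 0) (0, 1) z = ?w j" if "j \<in> ?B" for j
    using f2_commute assms that in_Basis_prod by blast
  have A: "(\<Sum>i\<in>?B. f3 (j, 0) (i, 0) (i, 0) z) = ?w j - (\<Sum>i\<in>?B. 2 * ?p i * ?h i j)" if "j \<in> ?B" for j
    using log_heat_partials[OF assms, of "(j, 0)"] that rot by (simp add: sum.distrib)
  have B: "(\<Sum>i\<in>?B. f3 (0, 1) (i, 0) (i, 0) z) = f2 (0, 1) (0, 1) z - (\<Sum>i\<in>?B. 2 * ?p i * ?w i)"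
    using log_heat_partials[OF assms, of "(0, 1)"] rot sym by (simp add: sum.distrib)
  have "(\<Sum>i\<in>?B. Q2 \<alpha> (i, 0) (i, 0) z) = (\<Sum>i\<in>?B. \<Sum>j\<in>?B. 2 * (?h j i)\<^sup>2)
     + (\<Sum>i\<in>?B. \<Sum>j\<in>?B. 2 * ?p j * f3 (j, 0) (i, 0) (i, 0) z) - \<alpha> * (\<Sum>i\<in>?B. f3 (0, 1) (i, 0) (i, 0) z)"
    by (simp add: Q2_def sum_subtractf sum.distrib sum_distrib_left power2_eq_square mult.assoc)
  also have "(\<Sum>i\<in>?B. \<Sum>j\<in>?B. 2 * (?h j i)\<^sup>2) = 2 * (\<Sum>j\<in>?B. \<Sum>i\<in>?B. (?h j i)\<^sup>2)"
    by (subst sum.swap) (simp add: sum_distrib_left)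
  also have "(\<Sum>i\<in>?B. \<Sum>j\<in>?B. 2 * ?p j * f3 (j, 0) (i, 0) (i, 0) z)
      = (\<Sum>j\<in>?B. 2 * ?p j * (\<Sum>i\<in>?B. f3 (j, 0) (i, 0) (i, 0) z))"
    by (subst sum.swap) (simp add: sum_distrib_left)
  also have "\<dots> = (\<Sum>j\<in>?B. 2 * ?p j * ?w j) - (\<Sum>j\<in>?B. \<Sum>i\<in>?B. 4 * ?p j * ?p i * ?h i j)"
    by (simp add: A right_diff_distrib sum_subtractf sum_distrib_left mult_ac)
  also note B
  finally have L: "(\<Sum>i\<in>?B. Q2 \<alpha> (i, 0) (i, 0) z) = 2 * (\<Sum>j\<in>?B. \<Sum>i\<in>?B. (?h j i)\<^sup>2)
    + ((\<Sum>j\<in>?B. 2 * ?p j * ?w j) - (\<Sum>j\<in>?B. \<Sum>i\<in>?B. 4 * ?p j * ?p i * ?h i j))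
    - \<alpha> * (f2 (0, 1) (0, 1) z - (\<Sum>i\<in>?B. 2 * ?p i * ?w i))" .
  have "2 * (\<Sum>i\<in>?B. ?p i * Q1 \<alpha> (i, 0) z) = (\<Sum>i\<in>?B. \<Sum>j\<in>?B. 4 * ?p i * ?p j * ?h j i) - \<alpha> * (\<Sum>i\<in>?B. 2 * ?p i * ?w i)"
    by (simp add: Q1_def right_diff_distrib sum_subtractf sum_distrib_left mult_ac)
  moreover have "Q1 \<alpha> (0, 1) z = (\<Sum>j\<in>?B. 2 * ?p j * ?w j) - \<alpha> * f2 (0, 1) (0, 1) z"
    by (simp add: Q1_def sym)
  ultimately show ?thesis using L by (simp add: right_diff_distrib)
qed

text \<open>The polynomial is not truncated: it is negative beyond radius R, so every maximum is
  taken inside the ball. In return its derivatives are explicit, with all pure second derivatives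
  equal to -2 / R^2.\<close>

definition cutoff :: "'a \<Rightarrow> real \<Rightarrow> 'a \<Rightarrow> real" where
  "cutoff p R x = 1 - ((x - p) \<bullet> (x - p)) / R\<^sup>2"

text \<open>Space gives the usual first and second order conditions along each coordinate line. Time
  is one-sided, since only times up to t0 are compared, so it yields an inequality for the time
  derivative. These are exactly the inputs of \<open>li_yau_max_algebra\<close>.\<close>

lemma interior_max:
  fixes \<alpha> :: real
  assumes x0: "x0 \<in> \<Omega>" and st: "0 < s" "s < t0" "t0 < T" and R: "R > 0" and \<alpha>: "\<alpha> > 1"
    and cut: "0 < cutoff p R x0" and Qpos: "0 < Q \<alpha> (x0, t0)"
    and max: "\<And>x t. \<lbrakk>x \<in> \<Omega>; norm (x - p) < R; s \<le> t; t \<le> t0\<rbrakk> \<Longrightarrow>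
       (t - s) * (cutoff p R x)\<^sup>2 * Q \<alpha> (x, t) \<le> (t0 - s) * (cutoff p R x0)\<^sup>2 * Q \<alpha> (x0, t0)"
  shows "(t0 - s) * (cutoff p R x0)\<^sup>2 * Q \<alpha> (x0, t0) \<le> real DIM('a) * \<alpha>\<^sup>2 / 2 *
      (1 + (t0 - s) * (24 + 4 * real DIM('a) + 4 * real DIM('a) * \<alpha>\<^sup>2 / (\<alpha> - 1)) / R\<^sup>2)"
proof -
  have z0: "(x0, t0) \<in> \<Omega> \<times> {0<..<T}" using x0 st by auto
  have inner_R: "(x - p) \<bullet> (x - p) < R\<^sup>2 \<longleftrightarrow> norm (x - p) < R" for x
    using R abs_le_square_iff[of R "norm (x - p)"] by (auto simp: dot_square_norm not_le[symmetric])
  have x0R: "norm (x0 - p) < R"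
    using cut R by (simp add: cutoff_def inner_R[symmetric])
  define \<sigma> where "\<sigma> = t0 - s"
  have \<sigma>: "\<sigma> > 0" using st by (simp add: \<sigma>_def)
  have "open (\<Omega> \<inter> ball p R)" using open_domain by auto
  moreover have "x0 \<in> \<Omega> \<inter> ball p R" using x0 x0R by (simp add: dist_norm norm_minus_commute)
  ultimately obtain d where d: "d > 0" "ball x0 d \<subseteq> \<Omega> \<inter> ball p R" using open_contains_ball by blast
  define dz where "dz i = - 2 * ((x0 - p) \<bullet> i) / R\<^sup>2" for i
  let ?\<zeta> = "cutoff p R x0"
  have space: "?\<zeta> * Q1 \<alpha> (i, 0) (x0, t0) = - 2 * dz i * Q \<alpha> (x0, t0)"
     "?\<zeta>\<^sup>2 * Q2 \<alpha> (i, 0) (i, 0) (x0, t0) \<le> (6 * (dz i)\<^sup>2 + 4 * ?\<zeta> / R\<^sup>2) * Q \<alpha> (x0, t0)"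
    if i: "i \<in> Basis" for i
  proof -
    have line: "x0 + r *\<^sub>R i \<in> \<Omega>" "norm (x0 + r *\<^sub>R i - p) < R" if "\<bar>r\<bar> < d" for r
    proof -
      have "x0 + r *\<^sub>R i \<in> ball x0 d" using that i by (simp add: dist_norm)
      then have "x0 + r *\<^sub>R i \<in> \<Omega> \<inter> ball p R" by (rule subsetD[OF d(2)])
      then show "x0 + r *\<^sub>R i \<in> \<Omega>" "norm (x0 + r *\<^sub>R i - p) < R"
        by (auto simp: mem_ball dist_norm norm_minus_commute[of p])
    qed
    let ?z = "\<lambda>r. (x0, t0) + r *\<^sub>R (i, 0::real)"
    have z: "?z r \<in> interior X" "?z r \<in> X" if "\<bar>r\<bar> < d" for r
      using interior_X[OF line(1)[OF that], of t0] st interior_subset by auto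
    have ib: "(i, 0::real) \<in> Basis" using i by simp
    note dQ = has_partials_line[OF Q_partials z(1) ib, OF z(2)]
    note dQ1 = has_partials_line[OF Q1_partials z(1) ib, OF z(2) ib]
    define \<zeta> where "\<zeta> r = cutoff p R (x0 + r *\<^sub>R i)" for r
    define \<zeta>' where "\<zeta>' r = - 2 * ((x0 - p) \<bullet> i + r) / R\<^sup>2" for r
    have \<zeta>_eq: "\<zeta> r = 1 - ((x0 - p) \<bullet> (x0 - p) + 2 * r * ((x0 - p) \<bullet> i) + r * r) / R\<^sup>2" for r
    proof -
      have "(y + r *\<^sub>R i) \<bullet> (y + r *\<^sub>R i) = y \<bullet> y + 2 * r * (y \<bullet> i) + r * r" for y
        using i by (simp add: inner_add_left inner_add_right inner_commute[of i y] inner_same_Basis distrib_left)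
      from this[of "x0 - p"] have "(x0 + r *\<^sub>R i - p) \<bullet> (x0 + r *\<^sub>R i - p)
          = (x0 - p) \<bullet> (x0 - p) + 2 * r * ((x0 - p) \<bullet> i) + r * r"
        by (simp only: diff_add_eq)
      then show ?thesis by (simp add: \<zeta>_def cutoff_def)
    qed
    have d\<zeta>: "(\<zeta> has_real_derivative \<zeta>' r) (at r)" for r
      unfolding \<zeta>_eq[abs_def] \<zeta>'_def
      using R by (auto intro!: derivative_eq_intros simp: field_simps)
    have d\<zeta>': "(\<zeta>' has_real_derivative - 2 / R\<^sup>2) (at r)" for r
      unfolding \<zeta>'_def[abs_def] using R by (auto intro!: derivative_eq_intros simp: field_simps)
    define \<phi> where "\<phi> r = \<sigma> * ((\<zeta> r)\<^sup>2 * Q \<alpha> (?z r))" for r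
    define \<phi>' where "\<phi>' r = \<sigma> * (2 * \<zeta> r * \<zeta>' r * Q \<alpha> (?z r) + (\<zeta> r)\<^sup>2 * Q1 \<alpha> (i, 0) (?z r))" for r
    have d1: "(\<phi> has_real_derivative \<phi>' r) (at r)" if "\<bar>r\<bar> < d" for r
      unfolding \<phi>_def[abs_def] \<phi>'_def
      by (rule derivative_eq_intros d\<zeta> dQ that | simp)+
    have d2: "(\<phi>' has_real_derivative \<sigma> * (2 * (\<zeta>' 0)\<^sup>2 * Q \<alpha> (?z 0) - 4 / R\<^sup>2 * \<zeta> 0 * Q \<alpha> (?z 0)
        + 4 * \<zeta> 0 * \<zeta>' 0 * Q1 \<alpha> (i, 0) (?z 0) + (\<zeta> 0)\<^sup>2 * Q2 \<alpha> (i, 0) (i, 0) (?z 0))) (at 0)"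
      unfolding \<phi>'_def[abs_def]
      by (rule derivative_eq_intros d\<zeta> d\<zeta>' dQ dQ1 | simp add: d)+ (simp add: power2_eq_square algebra_simps)
    have le: "\<phi> r \<le> \<phi> 0" if "\<bar>r\<bar> < d" for r
      using max[OF line[OF that], of t0] st by (simp add: \<phi>_def \<zeta>_def \<sigma>_def mult.assoc)
    have zz: "\<zeta> 0 = ?\<zeta>" "\<zeta>' 0 = dz i" "?z 0 = (x0, t0)" by (simp_all add: \<zeta>_def \<zeta>'_def dz_def zero_prod_def[symmetric])
    have "\<phi>' 0 = 0" by (rule second_derivative_local_max(1)[OF d(1) d1 d2 le])
    then have "?\<zeta> * (2 * dz i * Q \<alpha> (x0, t0) + ?\<zeta> * Q1 \<alpha> (i, 0) (x0, t0)) = 0"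
      using \<sigma> unfolding \<phi>'_def zz mult_eq_0_iff[of \<sigma>] by (simp add: power2_eq_square algebra_simps)
    then show first: "?\<zeta> * Q1 \<alpha> (i, 0) (x0, t0) = - 2 * dz i * Q \<alpha> (x0, t0)"
      using cut by simp
    have "\<sigma> * (2 * (\<zeta>' 0)\<^sup>2 * Q \<alpha> (?z 0) - 4 / R\<^sup>2 * \<zeta> 0 * Q \<alpha> (?z 0)
        + 4 * \<zeta> 0 * \<zeta>' 0 * Q1 \<alpha> (i, 0) (?z 0) + (\<zeta> 0)\<^sup>2 * Q2 \<alpha> (i, 0) (i, 0) (?z 0)) \<le> 0"
      by (rule second_derivative_local_max(2)[OF d(1) d1 d2 le])
    then have "2 * (dz i)\<^sup>2 * Q \<alpha> (x0, t0) - 4 / R\<^sup>2 * ?\<zeta> * Q \<alpha> (x0, t0)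
        + 4 * dz i * (?\<zeta> * Q1 \<alpha> (i, 0) (x0, t0)) + ?\<zeta>\<^sup>2 * Q2 \<alpha> (i, 0) (i, 0) (x0, t0) \<le> 0"
      using \<sigma> unfolding zz by (simp add: mult_le_0_iff mult_ac)
    \<comment> \<open>The first order condition turns the mixed term into -8 (dz i)^2 Q; together
      with 2 (dz i)^2 Q this gives the constant 6.\<close>
    then show "?\<zeta>\<^sup>2 * Q2 \<alpha> (i, 0) (i, 0) (x0, t0) \<le> (6 * (dz i)\<^sup>2 + 4 * ?\<zeta> / R\<^sup>2) * Q \<alpha> (x0, t0)"
      unfolding first by (simp add: power2_eq_square algebra_simps)
  qed
  have time: "- Q \<alpha> (x0, t0) \<le> \<sigma> * Q1 \<alpha> (0, 1) (x0, t0)"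
  proof (rule ccontr)
    assume neg: "\<not> ?thesis"
    let ?z = "\<lambda>r. (x0, t0) + r *\<^sub>R (0 :: 'a, 1::real)"
    have z: "?z 0 \<in> interior X" "?z 0 \<in> X" using interior_X[OF x0, of t0] st interior_subset
      by (auto simp: zero_prod_def[symmetric])
    have "((\<lambda>r. Q \<alpha> (?z r)) has_real_derivative Q1 \<alpha> (0, 1) (?z 0)) (at 0)"
      by (rule has_partials_line[OF Q_partials[OF z(2)] z(1)]) simp
    then have dQ: "((\<lambda>r. Q \<alpha> (?z r)) has_real_derivative Q1 \<alpha> (0, 1) (x0, t0)) (at 0)"
      by (simp add: zero_prod_def[symmetric])
    have "((\<lambda>r. (\<sigma> + r) * ?\<zeta>\<^sup>2 * Q \<alpha> (?z r)) has_real_derivative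
       ?\<zeta>\<^sup>2 * (Q \<alpha> (x0, t0) + \<sigma> * Q1 \<alpha> (0, 1) (x0, t0))) (at 0)"
      by (rule derivative_eq_intros dQ | simp)+ (simp add: algebra_simps zero_prod_def[symmetric])
    moreover have "?\<zeta>\<^sup>2 * (Q \<alpha> (x0, t0) + \<sigma> * Q1 \<alpha> (0, 1) (x0, t0)) < 0"
      using neg cut by (intro mult_pos_neg) auto
    \<comment> \<open>A negative time derivative would make the localised Q larger slightly before
      t0, at times that are still later than s.\<close>
    ultimately obtain e where e: "e > 0" "\<And>h. 0 < h \<Longrightarrow> h < e \<Longrightarrow>
      (\<sigma> + 0) * ?\<zeta>\<^sup>2 * Q \<alpha> (?z 0) < (\<sigma> + (0 - h)) * ?\<zeta>\<^sup>2 * Q \<alpha> (?z (0 - h))"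
      by (meson DERIV_neg_dec_left)
    define h where "h = min e \<sigma> / 2"
    have h: "0 < h" "h < e" "h < \<sigma>" using e \<sigma> by (auto simp: h_def)
    have "(t0 - h - s) * ?\<zeta>\<^sup>2 * Q \<alpha> (x0, t0 - h) \<le> (t0 - s) * ?\<zeta>\<^sup>2 * Q \<alpha> (x0, t0)"
      using h by (intro max x0 x0R) (auto simp: \<sigma>_def)
    with e(2)[OF h(1,2)] show False by (simp add: \<sigma>_def algebra_simps)
  qed
  have hess: "(f1 (0, 1) (x0, t0) - (\<Sum>i\<in>Basis. (f1 (i, 0) (x0, t0))\<^sup>2))\<^sup>2
     \<le> real DIM('a) * (\<Sum>j\<in>Basis. \<Sum>i\<in>Basis. (f2 (j, 0) (i, 0) (x0, t0))\<^sup>2)"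
  proof -
    have "f1 (0, 1) (x0, t0) - (\<Sum>i\<in>Basis. (f1 (i, 0) (x0, t0))\<^sup>2) = (\<Sum>i\<in>(Basis :: 'a set). f2 (i, 0) (i, 0) (x0, t0))"
      using log_heat[of "(x0, t0)"] z0 closure_subset[of \<Omega>] by (auto simp: sum.distrib)
    then show ?thesis using sum_power2_le_hessian[of "Basis :: 'a set" "\<lambda>j i. f2 (j, 0) (i, 0) (x0, t0)"] by simp
  qed
  have grad\<zeta>: "(\<Sum>i\<in>Basis. (dz i)\<^sup>2) \<le> 4 / R\<^sup>2"
  proof -
    have "(\<Sum>i\<in>Basis. (dz i)\<^sup>2) = 4 / R\<^sup>2 / R\<^sup>2 * (\<Sum>i\<in>Basis. ((x0 - p) \<bullet> i)\<^sup>2)"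
      by (simp add: dz_def power_divide power_mult_distrib sum_distrib_left)
    also have "(\<Sum>i\<in>Basis. ((x0 - p) \<bullet> i)\<^sup>2) = (x0 - p) \<bullet> (x0 - p)"
      by (subst (2) euclidean_inner) (simp add: power2_eq_square)
    also have "4 / R\<^sup>2 / R\<^sup>2 * ((x0 - p) \<bullet> (x0 - p)) \<le> 4 / R\<^sup>2 / R\<^sup>2 * R\<^sup>2"
      using inner_R[of x0] x0R by (intro mult_left_mono) auto
    also have "\<dots> = 4 / R\<^sup>2" using R by (simp add: field_simps power2_eq_square)
    finally show ?thesis .
  qed
  have "?\<zeta> \<le> 1" by (simp add: cutoff_def)
  from li_yau_max_algebra[OF finite_Basis nonempty_Basis cut this Qpos \<alpha> \<sigma> R space time bochner[OF z0] hess _ grad\<zeta>]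
  show ?thesis by (simp add: Q_def \<sigma>_def)
qed

end

subsection \<open>Boundary geometry of convex domains\<close>

lemma defining_function_has_derivative:
  assumes "local_defining_function \<Omega> U \<phi>" "y \<in> U"
  shows "(\<phi> has_derivative (\<lambda>h. grad \<phi> y \<bullet> h)) (at y)"
proof -
  have "smooth_on U \<phi>" using assms(1) by (simp add: local_defining_function_def)
  from has_derivative_pderivs[OF this assms(2), of "[]"]
  have "(\<phi> has_derivative (\<lambda>h. \<Sum>b\<in>Basis. (h \<bullet> b) * pderivs [b] \<phi> y)) (at y)" by simp
  moreover have "grad \<phi> y \<bullet> h = (\<Sum>b\<in>Basis. (h \<bullet> b) * pderivs [b] \<phi> y)" for h
    unfolding grad_def inner_sum_left by (intro sum.cong) (simp_all add: inner_commute[of h])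
  ultimately show ?thesis by (simp only:)
qed

lemma defining_function_line:
  assumes "local_defining_function \<Omega> U \<phi>" "y \<in> U"
  shows "((\<lambda>h. \<phi> (y + h *\<^sub>R w)) has_real_derivative grad \<phi> y \<bullet> w) (at 0)"
proof -
  have "((\<lambda>h. y + h *\<^sub>R w) has_derivative (\<lambda>h. h *\<^sub>R w)) (at 0)"
    by (auto intro!: derivative_eq_intros)
  moreover have "(\<phi> has_derivative (\<lambda>h. grad \<phi> y \<bullet> h)) (at (y + 0 *\<^sub>R w))"
    using defining_function_has_derivative[OF assms] by simp
  ultimately have "((\<lambda>h. \<phi> (y + h *\<^sub>R w)) has_derivative (\<lambda>h. grad \<phi> y \<bullet> (h *\<^sub>R w))) (at 0)"
    by (rule has_derivative_compose)
  then show ?thesis unfolding has_field_derivative_def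
    by (rule has_derivative_eq_rhs) (simp add: fun_eq_iff)
qed

text \<open>A defining function only has its sign prescribed inside \<Omega>. It is nonnegative at a
  frontier point because \<Omega> is open, and a positive value would by continuity keep a whole
  neighbourhood away from \<Omega>.\<close>

lemma defining_function_frontier:
  assumes "local_defining_function \<Omega> U \<phi>" "open \<Omega>" "y \<in> U" "y \<in> frontier \<Omega>"
  shows "\<phi> y = 0"
proof -
  have eq: "\<Omega> \<inter> U = {y \<in> U. \<phi> y < 0}" using assms(1) by (simp add: local_defining_function_def)
  have "y \<notin> \<Omega>" using assms(2,4) by (simp add: frontier_def interior_open)
  then have "\<phi> y \<ge> 0" using eq assms(3) by (metis (mono_tags, lifting) IntD1 mem_Collect_eq not_le)
  moreover have "\<not> \<phi> y > 0"
  proof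
    assume pos: "\<phi> y > 0"
    have "isCont \<phi> y" using defining_function_has_derivative[OF assms(1,3)] by (rule has_derivative_continuous)
    then have "\<forall>\<^sub>F x in nhds y. \<phi> x > 0"
      using pos by (metis continuous_at_imp_continuous_at_within tendsto_at_iff_tendsto_nhds isCont_def order_tendstoD(1))
    moreover have "\<forall>\<^sub>F x in nhds y. x \<in> U"
      using assms(1,3) eventually_nhds_in_open by (auto simp: local_defining_function_def)
    ultimately have "\<forall>\<^sub>F x in nhds y. \<phi> x > 0 \<and> x \<in> U" by (rule eventually_conj)
    then obtain V where "open V" "y \<in> V" "\<forall>x\<in>V. \<phi> x > 0 \<and> x \<in> U" unfolding eventually_nhds by blast
    have "V \<inter> \<Omega> = {}"
    proof (intro equals0I)
      fix z assume z: "z \<in> V \<inter> \<Omega>"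
      then have "z \<in> {y \<in> U. \<phi> y < 0}" "\<phi> z > 0" using \<open>\<forall>x\<in>V. \<phi> x > 0 \<and> x \<in> U\<close> eq by blast+
      then show False by simp
    qed
    moreover have "y \<in> closure \<Omega>" using assms(4) by (simp add: frontier_def)
    ultimately show False using \<open>open V\<close> \<open>y \<in> V\<close> by (metis disjoint_iff open_Int_closure_eq_empty)
  qed
  ultimately show ?thesis by simp
qed

text \<open>Near y membership in \<Omega> is the sign of \<phi>, and \<phi> vanishes at y, so a
  nonzero directional derivative decides on which side a short ray lies. Tangential directions stay
  undecided.\<close>

lemma defining_function_direction:
  assumes ldf: "local_defining_function \<Omega> U \<phi>" and \<Omega>: "open \<Omega>" and y: "y \<in> U" "y \<in> frontier \<Omega>"
  shows "grad \<phi> y \<bullet> w < 0 \<Longrightarrow> \<exists>d>0. \<forall>h. 0 < h \<and> h < d \<longrightarrow> y + h *\<^sub>R w \<in> \<Omega>"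
    and "grad \<phi> y \<bullet> w > 0 \<Longrightarrow> \<exists>d>0. \<forall>h. 0 < h \<and> h < d \<longrightarrow> y + h *\<^sub>R w \<notin> \<Omega>"
proof -
  have eq: "\<Omega> \<inter> U = {y \<in> U. \<phi> y < 0}" and U: "open U"
    using ldf by (simp_all add: local_defining_function_def)
  have y0: "\<phi> y = 0" by (rule defining_function_frontier[OF ldf \<Omega> y])
  note d = defining_function_line[OF ldf y(1), of w]
  obtain e where e: "e > 0" "\<And>h. 0 < h \<Longrightarrow> h < e \<Longrightarrow> y + h *\<^sub>R w \<in> U"
  proof -
    have "((\<lambda>h. y + h *\<^sub>R w) \<longlongrightarrow> y + 0 *\<^sub>R w) (at_right 0)" by (intro tendsto_intros)
    then have "\<forall>\<^sub>F h in at_right 0. y + h *\<^sub>R w \<in> U"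
      using U y(1) by (intro topological_tendstoD[of _ y]) auto
    then show ?thesis using that unfolding eventually_at_right_field by auto
  qed
  show "\<exists>d>0. \<forall>h. 0 < h \<and> h < d \<longrightarrow> y + h *\<^sub>R w \<in> \<Omega>" if neg: "grad \<phi> y \<bullet> w < 0"
  proof -
    obtain d where "d > 0" "\<And>h. 0 < h \<Longrightarrow> h < d \<Longrightarrow> \<phi> (y + h *\<^sub>R w) < 0"
      using DERIV_neg_dec_right[OF d neg] y0 by auto
    then show ?thesis using e eq by (intro exI[of _ "min d e"]) auto
  qed
  show "\<exists>d>0. \<forall>h. 0 < h \<and> h < d \<longrightarrow> y + h *\<^sub>R w \<notin> \<Omega>" if neg: "grad \<phi> y \<bullet> w > 0"
  proof -
    obtain d where d: "d > 0" "\<And>h. 0 < h \<Longrightarrow> h < d \<Longrightarrow> \<phi> (y + h *\<^sub>R w) > 0"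
      using DERIV_pos_inc_right[OF d neg] y0 by auto
    show ?thesis
    proof (intro exI[of _ "min d e"] conjI allI impI notI)
      fix h assume h: "0 < h \<and> h < min d e" "y + h *\<^sub>R w \<in> \<Omega>"
      then have "y + h *\<^sub>R w \<in> {y \<in> U. \<phi> y < 0}" using e eq by auto
      with d(2)[of h] h show False by auto
    qed (use d e in auto)
  qed
qed

text \<open>A point of \<Omega> strictly on the outer side would make the segment from y start
  outside \<Omega>, whereas convexity puts all of it except y into the interior.\<close>

lemma supporting_halfspace:
  assumes ldf: "local_defining_function \<Omega> U \<phi>" and \<Omega>: "open \<Omega>" "convex \<Omega>" and y: "y \<in> U" "y \<in> frontier \<Omega>"
    and z: "z \<in> closure \<Omega>"
  shows "grad \<phi> y \<bullet> (z - y) \<le> 0"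
proof -
  have "\<Omega> \<subseteq> {z. grad \<phi> y \<bullet> z \<le> grad \<phi> y \<bullet> y}"
  proof (rule ccontr)
    assume "\<not> ?thesis"
    then obtain z where z0: "z \<in> \<Omega>" "\<not> grad \<phi> y \<bullet> z \<le> grad \<phi> y \<bullet> y" by blast
    then have z: "z \<in> \<Omega>" "grad \<phi> y \<bullet> (z - y) > 0" by (simp_all add: inner_diff_right)
    obtain d where d: "d > 0" "\<And>h. 0 < h \<Longrightarrow> h < d \<Longrightarrow> y + h *\<^sub>R (z - y) \<notin> \<Omega>"
      using defining_function_direction(2)[OF ldf \<Omega>(1) y z(2)] by blast
    define h where "h = min d 1 / 2"
    have h: "0 < h" "h < d" "h \<le> 1" using d by (auto simp: h_def)
    have "y - h *\<^sub>R (y - z) \<in> interior \<Omega>"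
      by (rule mem_interior_closure_convex_shrink) (use \<Omega> z y h in \<open>auto simp: interior_open frontier_def\<close>)
    then have "y - h *\<^sub>R (y - z) \<in> \<Omega>" using interior_subset by blast
    then have "y + h *\<^sub>R (z - y) \<in> \<Omega>" by (simp add: algebra_simps)
    with d(2)[OF h(1,2)] show False by blast
  qed
  then have "closure \<Omega> \<subseteq> {z. grad \<phi> y \<bullet> z \<le> grad \<phi> y \<bullet> y}"
    by (rule closure_minimal) (rule closed_halfspace_le)
  with z show ?thesis by (auto simp: inner_diff_right)
qed

text \<open>Pushing p slightly along the normal stays in \<Omega>, so the weak inequality at the
  pushed point leaves a definite gap at p.\<close>

lemma supporting_halfspace_strict:
  assumes ldf: "local_defining_function \<Omega> U \<phi>" and \<Omega>: "open \<Omega>" "convex \<Omega>" and y: "y \<in> U" "y \<in> frontier \<Omega>"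
    and p: "p \<in> \<Omega>"
  shows "grad \<phi> y \<bullet> (p - y) < 0"
proof -
  let ?N = "grad \<phi> y"
  have N: "?N \<noteq> 0" using ldf y by (auto simp: local_defining_function_def)
  obtain e where e: "e > 0" "cball p e \<subseteq> \<Omega>" using \<Omega>(1) p open_contains_cball by blast
  have "p + (e / norm ?N) *\<^sub>R ?N \<in> cball p e" using N e by (simp add: dist_norm)
  then have "p + (e / norm ?N) *\<^sub>R ?N \<in> closure \<Omega>" using e closure_subset by blast
  from supporting_halfspace[OF ldf \<Omega> y this]
  have "?N \<bullet> (p - y) + (e / norm ?N) * (?N \<bullet> ?N) \<le> 0" by (simp add: inner_add_right inner_diff_right)
  moreover have "(e / norm ?N) * (?N \<bullet> ?N) > 0" using N e by simp
  ultimately show ?thesis by linarith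
qed

text \<open>Reads a derivative along a sequence whose rescaled secants converge: their boundedness
  makes the remainder negligible after division by \<open>s k\<close>. Differentiation along the
  frontier thus needs no parametrisation of it.\<close>

lemma has_derivative_tangent_sequence:
  fixes F :: "'a::real_normed_vector \<Rightarrow> 'b::real_normed_vector"
  assumes F: "(F has_derivative F') (at x within S)"
    and x: "\<And>k. xs k \<in> S" "xs \<longlonglongrightarrow> x" and s: "\<And>k. 0 < (s k :: real)"
    and v: "(\<lambda>k. (xs k - x) /\<^sub>R s k) \<longlonglongrightarrow> v"
  shows "(\<lambda>k. (F (xs k) - F x) /\<^sub>R s k) \<longlonglongrightarrow> F' v"
proof -
  have bl: "bounded_linear F'" using F by (rule has_derivative_bounded_linear)
  have main: "(\<lambda>k. F' ((xs k - x) /\<^sub>R s k)) \<longlonglongrightarrow> F' v"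
    by (rule bounded_linear.tendsto[OF bl v])
  obtain M where M: "\<And>k. norm ((xs k - x) /\<^sub>R s k) \<le> M" "M > 0"
    using v convergent_imp_Bseq[of "\<lambda>k. (xs k - x) /\<^sub>R s k"] unfolding Bseq_def convergent_def by blast
  have "(\<lambda>k. (F (xs k) - F x) /\<^sub>R s k - F' ((xs k - x) /\<^sub>R s k)) \<longlonglongrightarrow> 0"
  proof (rule LIMSEQ_I)
    fix r :: real assume r: "0 < r"
    define e where "e = r / (2 * M)"
    have e: "e > 0" using r M by (simp add: e_def)
    obtain d where d: "d > 0" "\<And>y. y \<in> S \<Longrightarrow> norm (y - x) < d \<Longrightarrow> norm (F y - F x - F' (y - x)) \<le> e * norm (y - x)"
      using F e unfolding has_derivative_within_alt by blast
    obtain n0 where n0: "\<And>k. k \<ge> n0 \<Longrightarrow> norm (xs k - x) < d" using LIMSEQ_D[OF x(2) d(1)] by blast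
    have "norm ((F (xs k) - F x) /\<^sub>R s k - F' ((xs k - x) /\<^sub>R s k) - 0) < r" if "k \<ge> n0" for k
    proof -
      have "(F (xs k) - F x) /\<^sub>R s k - F' ((xs k - x) /\<^sub>R s k) = (F (xs k) - F x - F' (xs k - x)) /\<^sub>R s k"
        unfolding linear_scale[OF bounded_linear.linear[OF bl]] by (simp only: scaleR_diff_right)
      also have "norm \<dots> = norm (F (xs k) - F x - F' (xs k - x)) / s k"
        using s[of k] by (simp add: divide_inverse mult.commute)
      also have "\<dots> \<le> e * norm (xs k - x) / s k"
        using d(2)[OF x(1) n0[OF that]] s[of k] by (intro divide_right_mono) auto
      also have "\<dots> = e * norm ((xs k - x) /\<^sub>R s k)" using s[of k] by (simp add: divide_inverse mult_ac)
      also have "\<dots> \<le> e * M" using M(1)[of k] e by (intro mult_left_mono) auto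
      also have "\<dots> < r" using r M by (simp add: e_def)
      finally show ?thesis by simp
    qed
    then show "\<exists>n0. \<forall>k\<ge>n0. norm ((F (xs k) - F x) /\<^sub>R s k - F' ((xs k - x) /\<^sub>R s k) - 0) < r" by blast
  qed
  from tendsto_add[OF this main] show ?thesis by simp
qed

text \<open>Takes the place of the implicit function theorem: every direction orthogonal to the
  gradient is a limit of rescaled secants between frontier points.\<close>

lemma frontier_tangent_sequence:
  assumes ldf: "local_defining_function \<Omega> U \<phi>" and \<Omega>: "open \<Omega>" and y: "y \<in> U" "y \<in> frontier \<Omega>"
    and v: "grad \<phi> y \<bullet> v = 0"
  shows "\<exists>xs s. (\<forall>k. xs k \<in> frontier \<Omega>) \<and> (\<forall>k. 0 < (s k :: real)) \<and> xs \<longlonglongrightarrow> y \<and> (\<lambda>k. (xs k - y) /\<^sub>R s k) \<longlonglongrightarrow> v"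
proof -
  let ?N = "grad \<phi> y"
  have N: "?N \<noteq> 0" using ldf y by (auto simp: local_defining_function_def)
  have ex: "\<exists>x s. x \<in> frontier \<Omega> \<and> 0 < s \<and> s < \<epsilon> \<and> norm ((x - y) /\<^sub>R s - v) \<le> \<epsilon> * norm ?N" if \<epsilon>: "\<epsilon> > 0" for \<epsilon> :: real
  proof -
    have 1: "?N \<bullet> (v + (- \<epsilon>) *\<^sub>R ?N) < 0" and 2: "?N \<bullet> (v + \<epsilon> *\<^sub>R ?N) > 0"
      using N \<epsilon> v by (simp_all add: inner_add_right inner_diff_right)
    obtain d1 where d1: "d1 > 0" "\<And>h. 0 < h \<Longrightarrow> h < d1 \<Longrightarrow> y + h *\<^sub>R (v + (- \<epsilon>) *\<^sub>R ?N) \<in> \<Omega>"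
      using defining_function_direction(1)[OF ldf \<Omega> y 1] by blast
    obtain d2 where d2: "d2 > 0" "\<And>h. 0 < h \<Longrightarrow> h < d2 \<Longrightarrow> y + h *\<^sub>R (v + \<epsilon> *\<^sub>R ?N) \<notin> \<Omega>"
      using defining_function_direction(2)[OF ldf \<Omega> y 2] by blast
    define s where "s = min \<epsilon> (min d1 d2) / 2"
    have s: "0 < s" "s < \<epsilon>" "s < d1" "s < d2" using \<epsilon> d1 d2 by (auto simp: s_def)
    \<comment> \<open>A short path across the boundary. The ends lie inside and outside \<Omega>, so
      by connectedness it meets the frontier, in a direction within \<epsilon> |N| of v.\<close>
    define c where "c \<theta> = y + s *\<^sub>R (v + \<theta> *\<^sub>R ?N)" for \<theta>
    have "connected (c ` {-\<epsilon>..\<epsilon>})" unfolding c_def by (intro connected_continuous_image continuous_intros) simp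
    moreover have "c (-\<epsilon>) \<in> c ` {-\<epsilon>..\<epsilon>}" "c \<epsilon> \<in> c ` {-\<epsilon>..\<epsilon>}" using \<epsilon> by (auto intro: imageI)
    moreover have "c (-\<epsilon>) \<in> \<Omega>" "c \<epsilon> \<notin> \<Omega>" using d1(2)[OF s(1,3)] d2(2)[OF s(1,4)] by (simp_all add: c_def)
    ultimately have "c ` {-\<epsilon>..\<epsilon>} \<inter> frontier \<Omega> \<noteq> {}" by (intro connected_Int_frontier) blast+
    then obtain \<theta> where \<theta>: "\<bar>\<theta>\<bar> \<le> \<epsilon>" "c \<theta> \<in> frontier \<Omega>" by (force simp: abs_le_iff)
    have "(c \<theta> - y) /\<^sub>R s - v = \<theta> *\<^sub>R ?N" using s by (simp add: c_def)
    then have "norm ((c \<theta> - y) /\<^sub>R s - v) \<le> \<epsilon> * norm ?N" using \<theta> by (simp add: mult_right_mono)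
    with \<theta> s show ?thesis by blast
  qed
  have "\<exists>x s. x \<in> frontier \<Omega> \<and> 0 < s \<and> s < 1 / real (Suc k) \<and> norm ((x - y) /\<^sub>R s - v) \<le> 1 / real (Suc k) * norm ?N" for k
    by (rule ex) simp
  then obtain xs s where xs: "\<And>k. xs k \<in> frontier \<Omega>" and s: "\<And>k. 0 < s k" "\<And>k. s k < 1 / real (Suc k)"
    and conv: "\<And>k. norm ((xs k - y) /\<^sub>R s k - v) \<le> 1 / real (Suc k) * norm ?N" by metis
  have inv0: "(\<lambda>k. 1 / real (Suc k)) \<longlonglongrightarrow> 0" using LIMSEQ_inverse_real_of_nat by (simp add: inverse_eq_divide)
  have s0: "s \<longlonglongrightarrow> 0"
    by (intro tendsto_sandwich[OF _ _ tendsto_const inv0] always_eventually allI less_imp_le s)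
  have "(\<lambda>k. 1 / real (Suc k) * norm ?N) \<longlonglongrightarrow> 0" using tendsto_mult_left_zero[OF inv0] by simp
  then have "(\<lambda>k. (xs k - y) /\<^sub>R s k - v) \<longlonglongrightarrow> 0"
    by (rule Lim_null_comparison[rotated]) (intro always_eventually allI conv)
  then have lim: "(\<lambda>k. (xs k - y) /\<^sub>R s k) \<longlonglongrightarrow> v" by (simp add: LIM_zero_iff)
  have "(\<lambda>k. s k *\<^sub>R ((xs k - y) /\<^sub>R s k) + y) \<longlonglongrightarrow> 0 *\<^sub>R v + y"
    by (intro tendsto_intros s0 lim)
  moreover have "s k *\<^sub>R ((xs k - y) /\<^sub>R s k) + y = xs k" for k using s(1)[of k] by simp
  ultimately have "xs \<longlonglongrightarrow> y" by simp
  with xs s lim show ?thesis by blast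
qed

text \<open>Differentiating \<open>w \<bullet> \<nu> = 0\<close> along the boundary in the tangential direction \<open>w\<close>; the second
  fundamental form of a convex domain is nonnegative because its normals are monotone.\<close>

lemma tangential_field_normal_derivative:
  fixes w :: "'a::euclidean_space \<Rightarrow> 'a"
  assumes ldf: "local_defining_function \<Omega> U \<phi>" and \<Omega>: "open \<Omega>" "convex \<Omega>" and y: "y \<in> U" "y \<in> frontier \<Omega>"
    and w: "(w has_derivative W) (at y within closure \<Omega>)"
    and tangent: "\<And>x. x \<in> frontier \<Omega> \<Longrightarrow> x \<in> U \<Longrightarrow> grad \<phi> x \<bullet> w x = 0"
  shows "grad \<phi> y \<bullet> W (w y) \<le> 0"
proof -
  let ?N = "grad \<phi>"
  have U: "open U" "smooth_on U \<phi>" using ldf by (simp_all add: local_defining_function_def)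
  obtain xs s where xs: "\<And>k. xs k \<in> frontier \<Omega>" and s: "\<And>k. 0 < (s k :: real)" and lim: "xs \<longlonglongrightarrow> y"
    and v: "(\<lambda>k. (xs k - y) /\<^sub>R s k) \<longlonglongrightarrow> w y"
    using frontier_tangent_sequence[OF ldf \<Omega>(1) y tangent[OF y(2,1)]] by blast
  have xU: "\<forall>\<^sub>F k in sequentially. xs k \<in> U" using topological_tendstoD[OF lim U(1) y(1)] .
  have "(pderivs [b] \<phi> has_derivative (\<lambda>h. \<Sum>c\<in>Basis. (h \<bullet> c) * pderivs (c # [b]) \<phi> y)) (at y)"
    if "b \<in> Basis" for b
    by (rule has_derivative_pderivs[OF U(2) y(1)]) (use that in simp)
  then have "((\<lambda>x. \<Sum>b\<in>Basis. pderivs [b] \<phi> x *\<^sub>R b) has_derivative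
     (\<lambda>h. \<Sum>b\<in>Basis. (\<Sum>c\<in>Basis. (h \<bullet> c) * pderivs (c # [b]) \<phi> y) *\<^sub>R b)) (at y)"
    by (intro has_derivative_sum has_derivative_scaleR_left)
  then obtain N' where N': "(?N has_derivative N') (at y)" by (simp only: grad_def[abs_def])
  have wq: "(\<lambda>k. (w (xs k) - w y) /\<^sub>R s k) \<longlonglongrightarrow> W (w y)"
    by (rule has_derivative_tangent_sequence[OF w _ lim s v]) (use xs in \<open>auto simp: frontier_def\<close>)
  have Nq: "(\<lambda>k. (?N (xs k) - ?N y) /\<^sub>R s k) \<longlonglongrightarrow> N' (w y)"
    by (rule has_derivative_tangent_sequence[OF N' _ lim s v]) simp
  have Nlim: "(\<lambda>k. ?N (xs k)) \<longlonglongrightarrow> ?N y"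
    using has_derivative_continuous[OF N'] lim by (rule isCont_tendsto_compose)
  \<comment> \<open>A discrete product rule: with N taken at \<open>xs k\<close> in one term and w
    at y in the other, the sum telescopes to a difference of N . w at two frontier points, hence to
    0.\<close>
  have "(\<lambda>k. ?N (xs k) \<bullet> ((w (xs k) - w y) /\<^sub>R s k) + ((?N (xs k) - ?N y) /\<^sub>R s k) \<bullet> w y)
     \<longlonglongrightarrow> ?N y \<bullet> W (w y) + N' (w y) \<bullet> w y"
    by (intro tendsto_intros Nlim wq Nq)
  moreover have "(\<lambda>k. ?N (xs k) \<bullet> ((w (xs k) - w y) /\<^sub>R s k) + ((?N (xs k) - ?N y) /\<^sub>R s k) \<bullet> w y) \<longlonglongrightarrow> 0"
  proof (rule tendsto_eventually)
    show "\<forall>\<^sub>F k in sequentially. ?N (xs k) \<bullet> ((w (xs k) - w y) /\<^sub>R s k) + ((?N (xs k) - ?N y) /\<^sub>R s k) \<bullet> w y = 0"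
      using xU
    proof eventually_elim
      case (elim k)
      have "?N (xs k) \<bullet> ((w (xs k) - w y) /\<^sub>R s k) + ((?N (xs k) - ?N y) /\<^sub>R s k) \<bullet> w y
        = (?N (xs k) \<bullet> w (xs k) - ?N y \<bullet> w y) / s k"
        using s[of k] by (simp add: inner_diff_left inner_diff_right divide_inverse algebra_simps)
      then show ?case using tangent[OF xs elim] tangent[OF y(2,1)] by simp
    qed
  qed
  ultimately have "?N y \<bullet> W (w y) + N' (w y) \<bullet> w y = 0" by (rule LIMSEQ_unique)
  moreover have "N' (w y) \<bullet> w y \<ge> 0"
  proof (rule tendsto_lowerbound)
    show "(\<lambda>k. ((?N (xs k) - ?N y) /\<^sub>R s k) \<bullet> ((xs k - y) /\<^sub>R s k)) \<longlonglongrightarrow> N' (w y) \<bullet> w y"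
      by (intro tendsto_intros Nq v)
    show "\<forall>\<^sub>F k in sequentially. 0 \<le> ((?N (xs k) - ?N y) /\<^sub>R s k) \<bullet> ((xs k - y) /\<^sub>R s k)"
      using xU
    proof eventually_elim
      case (elim k)
      have cl: "xs k \<in> closure \<Omega>" "y \<in> closure \<Omega>" using xs y by (auto simp: frontier_def)
      \<comment> \<open>Adding the supporting inequalities at the two points gives monotonicity of
        the unnormalised normals.\<close>
      have "?N y \<bullet> (xs k - y) \<le> 0" "?N (xs k) \<bullet> (y - xs k) \<le> 0"
        using supporting_halfspace[OF ldf \<Omega> y cl(1)] supporting_halfspace[OF ldf \<Omega> elim xs cl(2)] by auto
      then have "(?N (xs k) - ?N y) \<bullet> (xs k - y) \<ge> 0" by (simp add: inner_diff_left inner_diff_right)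
      then show ?case using s[of k] by simp
    qed
  qed simp
  ultimately show ?thesis by linarith
qed

lemma continuous_eq_on_closure:
  fixes F G :: "'a::metric_space \<Rightarrow> 'b::t2_space"
  assumes "continuous_on X F" "continuous_on X G" "Y \<subseteq> X" "X \<subseteq> closure Y"
    and "\<And>y. y \<in> Y \<Longrightarrow> F y = G y" "x \<in> X"
  shows "F x = G x"
proof -
  obtain s where s: "\<And>n. s n \<in> Y" "s \<longlonglongrightarrow> x" 
    using subsetD[OF assms(4,6), unfolded closure_sequential] by blast
  have X: "\<forall>\<^sub>F n in sequentially. s n \<in> X" using s(1) assms(3) by (auto intro: always_eventually)
  have "(\<lambda>n. F (s n)) \<longlonglongrightarrow> F x" by (rule continuous_on_tendsto_compose[OF assms(1) s(2) assms(6) X])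
  moreover have "(\<lambda>n. G (s n)) \<longlonglongrightarrow> G x" by (rule continuous_on_tendsto_compose[OF assms(2) s(2) assms(6) X])
  ultimately show ?thesis using assms(5)[OF s(1)] by (simp add: LIMSEQ_unique)
qed

subsection \<open>The local estimate\<close>

context neumann_heat_jet
begin

section \<open>Normal derivative of Q and exclusion of a boundary maximum\<close>

lemma continuous_on_jet:
  assumes "bs \<in> lists Basis"
  shows "continuous_on X (g bs)"
  using jet[OF assms] unfolding has_partials_def
  by (meson continuous_on_eq_continuous_within has_derivative_continuous)

lemma X_subset_closure: "X \<subseteq> closure (\<Omega> \<times> {0<..<T})"
  by (auto simp: closure_Times intro: subsetD[OF closure_subset])

lemma commute_closure:
  assumes "a \<in> Basis" "b \<in> Basis" "z \<in> X"
  shows "g [a, b] z = g [b, a] z"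
proof (rule continuous_eq_on_closure[OF _ _ _ X_subset_closure _ assms(3)])
  show "continuous_on X (g [a, b])" "continuous_on X (g [b, a])"
    using assms by (intro continuous_on_jet; simp)+
  show "\<Omega> \<times> {0<..<T} \<subseteq> X" using closure_subset by auto
  show "g [a, b] y = g [b, a] y" if "y \<in> \<Omega> \<times> {0<..<T}" for y
    by (rule commute[OF assms(1,2) _ that]) simp
qed

text \<open>The first claim differentiates the Neumann condition in time. The second applies the
  convexity lemma to the vector field Du at a fixed time, which is tangent to the frontier by that
  condition.\<close>

lemma frontier_normal_derivatives:
  assumes ldf: "local_defining_function \<Omega> U \<phi>" and x: "x \<in> U" "x \<in> frontier \<Omega>" and t: "t \<in> {0<..<T}"
  shows "(\<Sum>i\<in>Basis. (grad \<phi> x \<bullet> i) * g [(i, 0), (0, 1)] (x, t)) = 0"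
    and "(\<Sum>j\<in>Basis. g [(j, 0)] (x, t) * (\<Sum>i\<in>Basis. (grad \<phi> x \<bullet> i) * g [(i, 0), (j, 0)] (x, t))) \<le> 0"
proof -
  let ?N = "grad \<phi> x"
  have xt: "(x, t') \<in> X" if "t' \<in> {0<..<T}" for t' using that x by (auto simp: frontier_def)
  \<comment> \<open>For x on the frontier the time slice is still an open interval, so the
    derivative within X restricts to an ordinary two-sided one.\<close>
  have "((\<lambda>r. g bs (x, r)) has_real_derivative g ((0, 1) # bs) (x, t)) (at t)" if bs: "bs \<in> lists Basis" for bs
  proof -
    let ?L = "\<lambda>h :: 'a \<times> real. \<Sum>b\<in>Basis. (h \<bullet> b) * g (b # bs) (x, t)"
    have "((\<lambda>r. (x, r)) has_derivative (\<lambda>h. (0, h))) (at t within {0<..<T})"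
      by (auto intro!: derivative_eq_intros)
    moreover have "(g bs has_derivative ?L) (at (x, t) within (\<lambda>r. (x, r)) ` {0<..<T})"
      by (rule has_derivative_subset[OF jet[OF bs xt[OF t], unfolded has_partials_def]]) (use xt in auto)
    ultimately have "((\<lambda>r. g bs (x, r)) has_derivative (\<lambda>h. ?L (0, h))) (at t within {0<..<T})"
      by (rule has_derivative_in_compose)
    moreover have "?L (0, h) = g ((0, 1) # bs) (x, t) * h" for h
      by (simp add: sum_inner_Basis_prod)
    ultimately have "((\<lambda>r. g bs (x, r)) has_real_derivative g ((0, 1) # bs) (x, t)) (at t within {0<..<T})"
      by (simp only: has_field_derivative_def)
    then show ?thesis using at_within_open[OF t] by simp
  qed
  then have "((\<lambda>r. \<Sum>i\<in>Basis. (?N \<bullet> i) * g [(i, 0)] (x, r)) has_real_derivative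
      (\<Sum>i\<in>Basis. (?N \<bullet> i) * g [(0, 1), (i, 0)] (x, t))) (at t)"
    by (intro DERIV_sum DERIV_cmult) auto
  moreover have "((\<lambda>r. \<Sum>i\<in>Basis. (?N \<bullet> i) * g [(i, 0)] (x, r)) has_real_derivative 0) (at t)"
    by (rule has_field_derivative_transform_within_open[of "\<lambda>_. 0" _ _ "{0<..<T}"])
       (use t neumann[OF x(2) _ x(1) ldf] in auto)
  ultimately have "(\<Sum>i\<in>Basis. (?N \<bullet> i) * g [(0, 1), (i, 0)] (x, t)) = 0" by (rule DERIV_unique)
  then show "(\<Sum>i\<in>Basis. (?N \<bullet> i) * g [(i, 0), (0, 1)] (x, t)) = 0"
    using commute_closure[OF in_Basis_prod(1) in_Basis_prod(2) xt[OF t]] by simp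
  define w where "w y = (\<Sum>i\<in>Basis. g [(i, 0)] (y, t) *\<^sub>R i)" for y :: 'a
  define W where "W h = (\<Sum>i\<in>Basis. (\<Sum>b\<in>Basis. ((h, 0) \<bullet> b) * g [b, (i, 0)] (x, t)) *\<^sub>R i)" for h :: 'a
  have w: "(w has_derivative W) (at x within closure \<Omega>)"
    unfolding w_def[abs_def] W_def[abs_def]
  proof (intro has_derivative_sum has_derivative_scaleR_left)
    fix i :: 'a assume i: "i \<in> Basis"
    have "((\<lambda>y. (y, t)) has_derivative (\<lambda>h. (h, 0))) (at x within closure \<Omega>)"
      by (auto intro!: derivative_eq_intros)
    moreover have "(g [(i, 0)] has_derivative (\<lambda>h. \<Sum>b\<in>Basis. (h \<bullet> b) * g [b, (i, 0)] (x, t))) (at (x, t) within (\<lambda>y. (y, t)) ` closure \<Omega>)"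
      by (rule has_derivative_subset[OF jet[of "[(i, 0)]", OF _ xt[OF t], unfolded has_partials_def]]) (use i t in auto)
    ultimately show "((\<lambda>y. g [(i, 0)] (y, t)) has_derivative (\<lambda>h. \<Sum>b\<in>Basis. ((h, 0) \<bullet> b) * g [b, (i, 0)] (x, t))) (at x within closure \<Omega>)"
      by (rule has_derivative_in_compose)
  qed
  have wi: "w y \<bullet> i = g [(i, 0)] (y, t)" if "i \<in> Basis" for y i using that by (simp add: w_def)
  have inner_w: "c \<bullet> w y = (\<Sum>i\<in>Basis. (c \<bullet> i) * g [(i, 0)] (y, t))" for c y
    by (subst euclidean_inner) (simp add: wi)
  have "?N \<bullet> W (w x) \<le> 0"
    by (rule tangential_field_normal_derivative[OF ldf open_domain convex_domain x w])
       (use neumann[OF _ t _ ldf] in \<open>simp add: inner_w\<close>)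
  moreover have "?N \<bullet> W (w x) = (\<Sum>j\<in>Basis. g [(j, 0)] (x, t) * (\<Sum>i\<in>Basis. (?N \<bullet> i) * g [(i, 0), (j, 0)] (x, t)))"
  proof -
    have W: "W h \<bullet> i = (\<Sum>j\<in>Basis. (h \<bullet> j) * g [(j, 0), (i, 0)] (x, t))" if i: "i \<in> Basis" for h i
      using i by (simp add: W_def sum_inner_Basis_prod)
    have "?N \<bullet> W (w x) = (\<Sum>i\<in>Basis. (?N \<bullet> i) * (\<Sum>j\<in>Basis. g [(j, 0)] (x, t) * g [(j, 0), (i, 0)] (x, t)))"
      by (subst euclidean_inner) (simp add: W wi)
    also have "\<dots> = (\<Sum>i\<in>Basis. \<Sum>j\<in>Basis. g [(j, 0)] (x, t) * ((?N \<bullet> i) * g [(i, 0), (j, 0)] (x, t)))"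
      unfolding sum_distrib_left
      by (intro sum.cong refl) (simp add: commute_closure[OF in_Basis_prod(2) in_Basis_prod(2) xt[OF t]])
    also have "\<dots> = (\<Sum>j\<in>Basis. g [(j, 0)] (x, t) * (\<Sum>i\<in>Basis. (?N \<bullet> i) * g [(i, 0), (j, 0)] (x, t)))"
      unfolding sum_distrib_left by (rule sum.swap)
    finally show ?thesis .
  qed
  ultimately show "(\<Sum>j\<in>Basis. g [(j, 0)] (x, t) * (\<Sum>i\<in>Basis. (?N \<bullet> i) * g [(i, 0), (j, 0)] (x, t))) \<le> 0"
    by simp
qed

text \<open>Passing to ln u costs only terms containing the normal derivative of u, which vanish.
  What remains is 2 / u^2 times the Hessian of u applied to Du and the normal, minus \<alpha> / u
  times the normal derivative of u_t.\<close>

lemma normal_derivative_Q: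
  assumes ldf: "local_defining_function \<Omega> U \<phi>" and x: "x \<in> U" "x \<in> frontier \<Omega>" and t: "t \<in> {0<..<T}"
  shows "(\<Sum>i\<in>Basis. (grad \<phi> x \<bullet> i) * Q1 \<alpha> (i, 0) (x, t)) \<le> 0"
proof -
  let ?N = "grad \<phi> x" and ?z = "(x, t)" and ?u = "g [] (x, t)"
  have u: "?u > 0" using positive[of ?z] x t by (auto simp: frontier_def)
  have f2: "(\<Sum>i\<in>Basis. (?N \<bullet> i) * f2 a (i, 0) ?z) = (\<Sum>i\<in>Basis. (?N \<bullet> i) * g [(i, 0), a] ?z) / ?u" for a
  proof -
    have "(\<Sum>i\<in>Basis. (?N \<bullet> i) * f2 a (i, 0) ?z) = (\<Sum>i\<in>Basis. (?N \<bullet> i) * g [(i, 0), a] ?z) / ?u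
       - f1 a ?z * ((\<Sum>i\<in>Basis. (?N \<bullet> i) * g [(i, 0)] ?z) / ?u)"
      by (simp add: f2_def f1_def[of "(_, 0)"] right_diff_distrib sum_subtractf sum_distrib_left sum_divide_distrib mult_ac)
    then show ?thesis using neumann[OF x(2) t x(1) ldf] by simp
  qed
  have "(\<Sum>i\<in>Basis. (?N \<bullet> i) * Q1 \<alpha> (i, 0) ?z)
    = (\<Sum>i\<in>Basis. \<Sum>j\<in>Basis. 2 * f1 (j, 0) ?z * ((?N \<bullet> i) * f2 (j, 0) (i, 0) ?z))
      - \<alpha> * (\<Sum>i\<in>Basis. (?N \<bullet> i) * f2 (0, 1) (i, 0) ?z)"
    by (simp add: Q1_def right_diff_distrib sum_subtractf sum_distrib_left mult_ac)
  also have "(\<Sum>i\<in>Basis. \<Sum>j\<in>Basis. 2 * f1 (j, 0) ?z * ((?N \<bullet> i) * f2 (j, 0) (i, 0) ?z))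
    = (\<Sum>j\<in>Basis. 2 * f1 (j, 0) ?z * (\<Sum>i\<in>Basis. (?N \<bullet> i) * f2 (j, 0) (i, 0) ?z))"
    unfolding sum_distrib_left by (rule sum.swap)
  also have "\<dots> = 2 / ?u\<^sup>2 * (\<Sum>j\<in>Basis. g [(j, 0)] ?z * (\<Sum>i\<in>Basis. (?N \<bullet> i) * g [(i, 0), (j, 0)] ?z))"
    unfolding f2 sum_distrib_left[of "2 / ?u\<^sup>2"]
    by (intro sum.cong refl) (simp add: f1_def power2_eq_square)
  finally show ?thesis
    using frontier_normal_derivatives[OF ldf x t] u by (simp add: f2 divide_le_0_iff)
qed

text \<open>Along the inward ray from x0 the cutoff grows at a strictly positive rate, because p is
  strictly inside the supporting halfspace, while Q does not decrease to first order. Hence the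
  product increases, against maximality.\<close>

lemma boundary_max:
  assumes x0: "x0 \<in> frontier \<Omega>" and t0: "t0 \<in> {0<..<T}" and p: "p \<in> \<Omega>" and R: "R > 0"
    and cut: "0 < cutoff p R x0" and Qpos: "0 < Q \<alpha> (x0, t0)"
    and max: "\<And>x. \<lbrakk>x \<in> closure \<Omega>; norm (x - p) < R\<rbrakk> \<Longrightarrow>
       (cutoff p R x)\<^sup>2 * Q \<alpha> (x, t0) \<le> (cutoff p R x0)\<^sup>2 * Q \<alpha> (x0, t0)"
  shows False
proof -
  obtain U \<phi> where x: "x0 \<in> U" and ldf: "local_defining_function \<Omega> U \<phi>"
    using smooth_domain x0 unfolding smooth_boundary_def by blast
  define N where "N = grad \<phi> x0"
  have NN: "N \<bullet> (- N) < 0" using ldf x by (auto simp: N_def local_defining_function_def)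
  have x0R: "norm (x0 - p) < R"
  proof -
    have "(norm (x0 - p))\<^sup>2 < R\<^sup>2" using cut R by (simp add: cutoff_def dot_square_norm)
    then show ?thesis using R by (simp add: power2_less_imp_less)
  qed
  obtain d1 where d1: "d1 > 0" "\<And>h. 0 < h \<Longrightarrow> h < d1 \<Longrightarrow> x0 + h *\<^sub>R (- N) \<in> \<Omega>"
    using defining_function_direction(1)[OF ldf open_domain x x0 NN[unfolded N_def]] unfolding N_def by blast
  \<comment> \<open>Short enough for the inward ray to stay both in \<Omega> and in the ball where
    the cutoff is positive.\<close>
  define d where "d = min d1 ((R - norm (x0 - p)) / norm N)"
  have Nn: "norm N > 0" using NN by auto
  have d: "d > 0" using d1 x0R Nn by (simp add: d_def)
  have in_closure: "x0 - h *\<^sub>R N \<in> closure \<Omega>" if "0 \<le> h" "h < d" for h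
  proof (cases "h = 0")
    case True then show ?thesis using x0 by (simp add: frontier_def)
  next
    case False
    then have "x0 + h *\<^sub>R (- N) \<in> \<Omega>" using that by (intro d1) (auto simp: d_def)
    then show ?thesis using closure_subset by auto
  qed
  have in_ball: "norm (x0 - h *\<^sub>R N - p) < R" if "0 \<le> h" "h < d" for h
  proof -
    have "norm (x0 - h *\<^sub>R N - p) \<le> norm (x0 - p) + norm (h *\<^sub>R N)"
      using norm_triangle_ineq4[of "x0 - p" "h *\<^sub>R N"] by (simp add: algebra_simps)
    also have "norm (h *\<^sub>R N) < R - norm (x0 - p)"
      using that Nn by (simp add: d_def pos_less_divide_eq)
    finally show ?thesis by simp
  qed
  have z0: "(x0, t0) \<in> X" using in_closure[of 0] d t0 by simp
  let ?S = "{0..<d}"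
  have dQ: "((\<lambda>h. Q \<alpha> (x0 - h *\<^sub>R N, t0)) has_real_derivative - (\<Sum>i\<in>Basis. (N \<bullet> i) * Q1 \<alpha> (i, 0) (x0, t0))) (at 0 within ?S)"
  proof -
    let ?L = "\<lambda>k :: 'a \<times> real. \<Sum>b\<in>Basis. (k \<bullet> b) * Q1 \<alpha> b (x0, t0)"
    have "((\<lambda>h. (x0 - h *\<^sub>R N, t0)) has_derivative (\<lambda>h. (- (h *\<^sub>R N), 0))) (at 0 within ?S)"
      by (auto intro!: derivative_eq_intros)
    moreover have "(Q \<alpha> has_derivative ?L) (at (x0 - 0 *\<^sub>R N, t0) within (\<lambda>h. (x0 - h *\<^sub>R N, t0)) ` ?S)"
      using has_derivative_subset[OF Q_partials[OF z0, unfolded has_partials_def]] in_closure t0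
      by (simp add: image_subset_iff)
    ultimately have "((\<lambda>h. Q \<alpha> (x0 - h *\<^sub>R N, t0)) has_derivative (\<lambda>h. ?L (- (h *\<^sub>R N), 0))) (at 0 within ?S)"
      by (rule has_derivative_in_compose)
    moreover have "?L (- (h *\<^sub>R N), 0) = - (\<Sum>i\<in>Basis. (N \<bullet> i) * Q1 \<alpha> (i, 0) (x0, t0)) * h" for h
      unfolding sum_inner_Basis_prod by (simp add: sum_negf sum_distrib_left mult_ac)
    ultimately show ?thesis by (simp only: has_field_derivative_def)
  qed
  have "grad \<phi> x0 \<bullet> (p - x0) < 0"
    by (rule supporting_halfspace_strict[OF ldf open_domain convex_domain x x0 p])
  then have pos: "(x0 - p) \<bullet> N > 0"
    by (simp add: N_def inner_diff_left inner_diff_right inner_commute)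
  have cut_eq: "cutoff p R (x0 - h *\<^sub>R N) = 1 - ((x0 - p) \<bullet> (x0 - p) - 2 * h * ((x0 - p) \<bullet> N) + h * h * (N \<bullet> N)) / R\<^sup>2" for h
  proof -
    have "(y - h *\<^sub>R N) \<bullet> (y - h *\<^sub>R N) = y \<bullet> y - 2 * h * (y \<bullet> N) + h * h * (N \<bullet> N)" for y
      by (simp add: inner_diff_left inner_diff_right inner_commute[of N y] algebra_simps)
    moreover have "x0 - h *\<^sub>R N - p = x0 - p - h *\<^sub>R N" by simp
    ultimately show ?thesis by (simp only: cutoff_def)
  qed
  have dcut: "((\<lambda>h. cutoff p R (x0 - h *\<^sub>R N)) has_real_derivative 2 * ((x0 - p) \<bullet> N) / R\<^sup>2) (at 0 within ?S)"
    unfolding cut_eq using R by (auto intro!: derivative_eq_intros simp: field_simps)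
  have "((\<lambda>h. (cutoff p R (x0 - h *\<^sub>R N))\<^sup>2 * Q \<alpha> (x0 - h *\<^sub>R N, t0)) has_real_derivative
     2 * cutoff p R x0 * (2 * ((x0 - p) \<bullet> N) / R\<^sup>2) * Q \<alpha> (x0, t0)
       + (cutoff p R x0)\<^sup>2 * - (\<Sum>i\<in>Basis. (N \<bullet> i) * Q1 \<alpha> (i, 0) (x0, t0))) (at 0 within ?S)"
    by (rule derivative_eq_intros dcut dQ | simp)+
  moreover have "2 * cutoff p R x0 * (2 * ((x0 - p) \<bullet> N) / R\<^sup>2) * Q \<alpha> (x0, t0)
       + (cutoff p R x0)\<^sup>2 * - (\<Sum>i\<in>Basis. (N \<bullet> i) * Q1 \<alpha> (i, 0) (x0, t0)) > 0"
    using normal_derivative_Q[OF ldf x x0 t0, of \<alpha>] cut pos Qpos R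
    by (intro add_pos_nonneg mult_pos_pos divide_pos_pos mult_nonneg_nonneg) (auto simp: N_def)
  ultimately obtain e where e: "e > 0" "\<And>h. 0 < h \<Longrightarrow> 0 + h \<in> ?S \<Longrightarrow> h < e \<Longrightarrow>
     (cutoff p R (x0 - 0 *\<^sub>R N))\<^sup>2 * Q \<alpha> (x0 - 0 *\<^sub>R N, t0)
      < (cutoff p R (x0 - (0 + h) *\<^sub>R N))\<^sup>2 * Q \<alpha> (x0 - (0 + h) *\<^sub>R N, t0)"
    using has_real_derivative_pos_inc_right by blast
  define h where "h = min d e / 2"
  have h: "0 < h" "h < d" "h < e" using d e by (auto simp: h_def)
  with e(2)[of h] max[OF in_closure[of h] in_ball[of h]] show False by simp
qed

text \<open>The cutoff equals 1 at p, so the left side is a value of G on the compact set K. A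
  positive maximum of G avoids the initial time through the factor t - s, the sphere of radius R
  through the cutoff, and the frontier by \<open>boundary_max\<close>.\<close>

lemma local_li_yau:
  fixes \<alpha> :: real
  assumes p: "p \<in> \<Omega>" and s: "0 < s" "s < \<tau>" "\<tau> < T" and R: "R > 0" and \<alpha>: "\<alpha> > 1"
  shows "(\<tau> - s) * Q \<alpha> (p, \<tau>) \<le> real DIM('a) * \<alpha>\<^sup>2 / 2 *
      (1 + \<tau> * (24 + 4 * real DIM('a) + 4 * real DIM('a) * \<alpha>\<^sup>2 / (\<alpha> - 1)) / R\<^sup>2)"
    (is "_ \<le> ?A * (1 + \<tau> * ?C / R\<^sup>2)")
proof -
  define G where "G = (\<lambda>z. (snd z - s) * (cutoff p R (fst z))\<^sup>2 * Q \<alpha> z)"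
  define K where "K = (closure \<Omega> \<inter> cball p R) \<times> {s..\<tau>}"
  have C: "?C \<ge> 0" using \<alpha> by simp
  have "compact K" unfolding K_def by (intro compact_Times closed_Int_compact) auto
  moreover have "(p, \<tau>) \<in> K" using p s R closure_subset by (auto simp: K_def)
  moreover have "continuous_on K G"
  proof -
    have "continuous_on X (Q \<alpha>)"
      using Q_partials unfolding has_partials_def
      by (meson continuous_on_eq_continuous_within has_derivative_continuous)
    then have "continuous_on K (Q \<alpha>)" by (rule continuous_on_subset) (use s in \<open>auto simp: K_def\<close>)
    then show ?thesis unfolding G_def cutoff_def using R by (intro continuous_intros) auto
  qed
  ultimately obtain z0 where "z0 \<in> K" and max: "\<And>z. z \<in> K \<Longrightarrow> G z \<le> G z0"
    using continuous_attains_sup[of K G] by (metis empty_iff)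
  then obtain x0 t0 where z0: "z0 = (x0, t0)" "x0 \<in> closure \<Omega>" "norm (x0 - p) \<le> R" "s \<le> t0" "t0 \<le> \<tau>"
    by (auto simp: K_def dist_norm norm_minus_commute)
  have inK: "(x, t) \<in> K" if "x \<in> closure \<Omega>" "norm (x - p) < R" "s \<le> t" "t \<le> \<tau>" for x t
    using that by (auto simp: K_def dist_norm norm_minus_commute)
  have "(\<tau> - s) * Q \<alpha> (p, \<tau>) = G (p, \<tau>)" by (simp add: G_def cutoff_def)
  also have "\<dots> \<le> G z0" by (rule max) fact
  also have "G z0 \<le> ?A * (1 + \<tau> * ?C / R\<^sup>2)"
  proof (cases "G z0 \<le> 0")
    case True
    also have "0 \<le> ?A * (1 + \<tau> * ?C / R\<^sup>2)"
      using C s \<alpha> by (intro mult_nonneg_nonneg add_nonneg_nonneg divide_nonneg_nonneg) auto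
    finally show ?thesis .
  next
    case False
    then have Gpos: "0 < (t0 - s) * (cutoff p R x0)\<^sup>2 * Q \<alpha> (x0, t0)" by (simp add: G_def z0)
    then have t0: "s < t0" using z0 by (cases "s = t0") auto
    have "cutoff p R x0 \<ge> 0" using z0(3) R
      by (simp add: cutoff_def dot_square_norm power_mono)
    moreover have "cutoff p R x0 \<noteq> 0" using Gpos by auto
    ultimately have cut: "cutoff p R x0 > 0" by simp
    have Qpos: "Q \<alpha> (x0, t0) > 0" using zero_less_mult_pos[OF Gpos] t0 cut by simp
    have t0T: "t0 \<in> {0<..<T}" using s z0 t0 by auto
    have "x0 \<in> \<Omega>"
    proof (rule ccontr)
      assume "x0 \<notin> \<Omega>"
      then have fr: "x0 \<in> frontier \<Omega>" using z0 open_domain by (simp add: frontier_def interior_open)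
      show False
      proof (rule boundary_max[OF fr t0T p R cut Qpos])
        fix x assume "x \<in> closure \<Omega>" "norm (x - p) < R"
        from max[OF inK[OF this, of t0]] z0 t0
        show "(cutoff p R x)\<^sup>2 * Q \<alpha> (x, t0) \<le> (cutoff p R x0)\<^sup>2 * Q \<alpha> (x0, t0)"
          by (simp add: G_def mult.assoc)
      qed
    qed
    have "(t0 - s) * (cutoff p R x0)\<^sup>2 * Q \<alpha> (x0, t0) \<le> ?A * (1 + (t0 - s) * ?C / R\<^sup>2)"
    proof (rule interior_max[OF \<open>x0 \<in> \<Omega>\<close> s(1) t0 _ R \<alpha> cut Qpos])
      show "t0 < T" using t0T by simp
      fix x t assume "x \<in> \<Omega>" "norm (x - p) < R" "s \<le> t" "t \<le> t0"
      then have "G (x, t) \<le> G z0" using z0 closure_subset by (intro max inK) auto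
      then show "(t - s) * (cutoff p R x)\<^sup>2 * Q \<alpha> (x, t) \<le> (t0 - s) * (cutoff p R x0)\<^sup>2 * Q \<alpha> (x0, t0)"
        by (simp add: G_def z0)
    qed
    \<comment> \<open>Replacing t0 - s by \<tau> removes the dependence on the unknown maximum
      point.\<close>
    also have "\<dots> \<le> ?A * (1 + \<tau> * ?C / R\<^sup>2)"
      using C s z0 by (intro mult_left_mono add_left_mono divide_right_mono mult_right_mono) auto
    finally show ?thesis by (simp add: G_def z0)
  qed
  finally show ?thesis .
qed

text \<open>The order of limits matters: the coefficient of 1 / R^2 blows up as \<alpha> tends to 1,
  so R goes to infinity first.\<close>

lemma li_yau:
  assumes p: "p \<in> \<Omega>" and \<tau>: "0 < \<tau>" "\<tau> < T"
  shows "f1 (0, 1) (p, \<tau>) - (\<Sum>j\<in>Basis. (f1 (j, 0) (p, \<tau>))\<^sup>2) \<ge> - real DIM('a) / (2 * \<tau>)"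
proof -
  have lim: "((\<lambda>R. A * (1 + B / R\<^sup>2)) \<longlongrightarrow> A) at_top" for A B :: real
  proof -
    have "((\<lambda>R. A * (1 + B * (inverse R)\<^sup>2)) \<longlongrightarrow> A * (1 + B * 0\<^sup>2)) at_top"
      by (intro tendsto_intros tendsto_inverse_0_at_top filterlim_ident)
    then show ?thesis by (simp add: divide_inverse power_inverse)
  qed
  have A: "(\<tau> - s) * Q \<alpha> (p, \<tau>) \<le> real DIM('a) * \<alpha>\<^sup>2 / 2" if s: "0 < s" "s < \<tau>" and \<alpha>: "\<alpha> > 1" for s \<alpha> :: real
  proof (rule tendsto_lowerbound)
    let ?C = "24 + 4 * real DIM('a) + 4 * real DIM('a) * \<alpha>\<^sup>2 / (\<alpha> - 1)"
    show "((\<lambda>R. real DIM('a) * \<alpha>\<^sup>2 / 2 * (1 + \<tau> * ?C / R\<^sup>2)) \<longlongrightarrow> real DIM('a) * \<alpha>\<^sup>2 / 2) at_top"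
      by (rule lim)
    show "\<forall>\<^sub>F R in at_top. (\<tau> - s) * Q \<alpha> (p, \<tau>) \<le> real DIM('a) * \<alpha>\<^sup>2 / 2 * (1 + \<tau> * ?C / R\<^sup>2)"
      using eventually_gt_at_top[of 0] by eventually_elim (rule local_li_yau[OF p s \<tau>(2) _ \<alpha>])
  qed simp
  let ?P = "\<Sum>j\<in>Basis. (f1 (j, 0) (p, \<tau>))\<^sup>2" and ?w = "f1 (0, 1) (p, \<tau>)"
  \<comment> \<open>The factors 1 are the limit value of \<alpha>; likewise the 0 further down is
    that of s.\<close>
  have B: "(\<tau> - s) * (?P - 1 * ?w) \<le> real DIM('a) * 1\<^sup>2 / 2" if s: "0 < s" "s < \<tau>" for s
  proof (rule tendsto_le)
    show "((\<lambda>\<alpha> :: real. real DIM('a) * \<alpha>\<^sup>2 / 2) \<longlongrightarrow> real DIM('a) * 1\<^sup>2 / 2) (at_right 1)"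
      by (rule tendsto_eq_intros refl | simp)+
    show "((\<lambda>\<alpha>. (\<tau> - s) * (?P - \<alpha> * ?w)) \<longlongrightarrow> (\<tau> - s) * (?P - 1 * ?w)) (at_right 1)" by (intro tendsto_intros)
    show "\<forall>\<^sub>F \<alpha> in at_right 1. (\<tau> - s) * (?P - \<alpha> * ?w) \<le> real DIM('a) * \<alpha>\<^sup>2 / 2"
      using A[OF s] by (auto simp: Q_def eventually_at_right_less eventually_at_filter)
  qed simp
  have "(\<tau> - 0) * (?P - 1 * ?w) \<le> real DIM('a) * 1\<^sup>2 / 2"
  proof (rule tendsto_upperbound)
    show "((\<lambda>s. (\<tau> - s) * (?P - 1 * ?w)) \<longlongrightarrow> (\<tau> - 0) * (?P - 1 * ?w)) (at_right 0)" by (intro tendsto_intros)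
    show "\<forall>\<^sub>F s in at_right 0. (\<tau> - s) * (?P - 1 * ?w) \<le> real DIM('a) * 1\<^sup>2 / 2"
      using B \<tau>(1) unfolding eventually_at_right_field by blast
  qed simp
  then show ?thesis using \<tau> by (simp add: field_simps)
qed

end

subsection \<open>Passage to the original solution\<close>

text \<open>The point x varies in the induction because the next derivative needs the identity on a
  neighbourhood of x, which the open set S provides.\<close>

lemma pderivs_slice:
  fixes f :: "'a::euclidean_space \<times> real \<Rightarrow> real"
  assumes "open S" "t \<in> J" "smooth_on (S \<times> J) f" "bs \<in> lists Basis" "x \<in> S"
  shows "pderivs bs (\<lambda>y. f (y, t)) x = pderivs (map (\<lambda>b. (b, 0)) bs) f (x, t)"
  using assms(4,5)
proof (induction bs arbitrary: x)
  case (Cons b bs)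
  let ?F = "pderivs (map (\<lambda>b. (b, 0)) bs) f"
  have bs: "b \<in> Basis" "bs \<in> lists Basis" using Cons.hyps by simp_all
  then have "map (\<lambda>b. (b, 0 :: real)) bs \<in> lists Basis" by auto
  then have "?F differentiable at (x, t)"
    using assms(2,3) Cons.prems unfolding smooth_on_def by blast
  then have F: "(?F has_derivative frechet_derivative ?F (at (x, t))) (at (x, t))"
    by (simp add: frechet_derivative_works)
  have "((\<lambda>y. (y, t)) has_derivative (\<lambda>h. (h, 0))) (at x)" by (auto intro!: derivative_eq_intros)
  from has_derivative_compose[OF this F]
  have d: "((\<lambda>y. ?F (y, t)) has_derivative (\<lambda>h. frechet_derivative ?F (at (x, t)) (h, 0))) (at x)" .
  have "(pderivs bs (\<lambda>y. f (y, t)) has_derivative (\<lambda>h. frechet_derivative ?F (at (x, t)) (h, 0))) (at x)"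
    by (rule has_derivative_transform_within_open[OF d assms(1)]) (use Cons in auto)
  from frechet_derivative_at[OF this, symmetric] show ?case by simp
qed simp

lemma deriv_time_slice:
  fixes f :: "'a::euclidean_space \<times> real \<Rightarrow> real"
  assumes "f differentiable at (x, t)"
  shows "deriv (\<lambda>s. f (x, s)) t = pderivs [(0, 1)] f (x, t)"
proof -
  let ?D = "frechet_derivative f (at (x, t))"
  have F: "(f has_derivative ?D) (at (x, t))" using assms by (simp add: frechet_derivative_works)
  have "((\<lambda>s. (x, s)) has_derivative (\<lambda>h. (0, h))) (at t)" by (auto intro!: derivative_eq_intros)
  from has_derivative_compose[OF this F]
  have d: "((\<lambda>s. f (x, s)) has_derivative (\<lambda>h. ?D (0, h))) (at t)" .
  have "?D (0, h) = ?D (0, 1) * h" for h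
    using linear_scale[OF has_derivative_linear[OF F], of h "(0, 1)"] by simp
  then have "(\<lambda>h. ?D (0, h)) = (*) (?D (0, 1))" by (rule ext)
  then have "((\<lambda>s. f (x, s)) has_real_derivative ?D (0, 1)) (at t)"
    unfolding has_field_derivative_def by (rule has_derivative_eq_rhs[OF d])
  then show ?thesis by (simp add: DERIV_imp_deriv)
qed

lemma norm_grad_power2: "(norm (grad f x))\<^sup>2 = (\<Sum>b\<in>Basis. (pderivs [b] f x)\<^sup>2)"
proof -
  have "grad f x \<bullet> b = pderivs [b] f x" if "b \<in> Basis" for b
    using that by (simp add: grad_def del: pderivs.simps)
  then show ?thesis
    by (simp add: power2_norm_eq_inner del: pderivs.simps) (subst euclidean_inner, simp add: power2_eq_square)
qed

lemma laplacian_ln: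
  fixes f :: "'a::euclidean_space \<Rightarrow> real"
  assumes S: "open S" and f: "\<And>bs y. bs \<in> lists Basis \<Longrightarrow> y \<in> S \<Longrightarrow> pderivs bs f differentiable at y"
    and pos: "\<And>y. y \<in> S \<Longrightarrow> 0 < f y" and x: "x \<in> S"
  shows "laplacian (\<lambda>y. ln (f y)) x = laplacian f x / f x - (norm (grad f x))\<^sup>2 / (f x)\<^sup>2"
proof -
  have d: "(pderivs bs f has_derivative frechet_derivative (pderivs bs f) (at y)) (at y)" if "bs \<in> lists Basis" "y \<in> S" for bs y
    using f[OF that] by (simp add: frechet_derivative_works)
  have d0: "(f has_derivative frechet_derivative f (at y)) (at y)" if "y \<in> S" for y
    using d[of "[]", OF _ that] by simp
  have first: "pderivs [b] (\<lambda>y. ln (f y)) y = pderivs [b] f y / f y" if "y \<in> S" for b y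
  proof -
    have "((\<lambda>y. ln (f y)) has_derivative (\<lambda>h. frechet_derivative f (at y) h / f y)) (at y)"
      using pos[OF that] by (auto intro!: derivative_eq_intros d0[OF that] simp: divide_inverse)
    from frechet_derivative_at[OF this, symmetric] show ?thesis by simp
  qed
  have second: "pderivs [b, b] (\<lambda>y. ln (f y)) x = pderivs [b, b] f x / f x - (pderivs [b] f x)\<^sup>2 / (f x)\<^sup>2"
    if b: "b \<in> Basis" for b
  proof -
    let ?D = "\<lambda>h. (frechet_derivative (pderivs [b] f) (at x) h * f x - pderivs [b] f x * frechet_derivative f (at x) h) / (f x * f x)"
    have "((\<lambda>y. pderivs [b] f y / f y) has_derivative ?D) (at x)"
      using pos[OF x] by (intro has_derivative_divide' d0[OF x] d[OF _ x]) (use b in auto)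
    then have "(pderivs [b] (\<lambda>y. ln (f y)) has_derivative ?D) (at x)"
      by (rule has_derivative_transform_within_open[OF _ S x]) (simp only: first)
    from fun_cong[OF frechet_derivative_at[OF this, symmetric], of b]
    have "pderivs [b, b] (\<lambda>y. ln (f y)) x = ?D b" by simp
    also have "\<dots> = pderivs [b, b] f x / f x - (pderivs [b] f x)\<^sup>2 / (f x)\<^sup>2"
      using pos[OF x] by (simp add: field_simps power2_eq_square)
    finally show ?thesis .
  qed
  have "laplacian (\<lambda>y. ln (f y)) x = (\<Sum>b\<in>Basis. pderivs [b, b] f x / f x - (pderivs [b] f x)\<^sup>2 / (f x)\<^sup>2)"
    unfolding laplacian_def by (intro sum.cong refl second)
  also have "\<dots> = laplacian f x / f x - (norm (grad f x))\<^sup>2 / (f x)\<^sup>2"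
    unfolding laplacian_def norm_grad_power2 by (simp only: sum_subtractf sum_divide_distrib)
  finally show ?thesis .
qed

text \<open>At a boundary point two derivatives within S are compared only in a direction pointing
  into S. This identifies the derivative in the Neumann condition with the one given by the
  jet.\<close>

lemma has_derivative_direction_unique:
  assumes "(f has_derivative L) (at x within S)" "(f has_derivative L') (at x within S)"
    and "0 < (d :: real)" "\<And>h. 0 < h \<Longrightarrow> h < d \<Longrightarrow> x + h *\<^sub>R w \<in> S"
  shows "L w = L' w"
proof -
  \<comment> \<open>The denominators start at 2 so that every step is strictly shorter than
    \<open>d\<close>.\<close>
  define s where "s k = d / real (Suc (Suc k))" for k
  have s: "0 < s k" "s k < d" for k using assms(3) by (simp_all add: s_def divide_less_eq)
  have s0: "s \<longlonglongrightarrow> 0"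
    unfolding s_def by (intro LIMSEQ_Suc lim_const_over_n[THEN LIMSEQ_Suc])
  have "(\<lambda>k. x + s k *\<^sub>R w) \<longlonglongrightarrow> x + 0 *\<^sub>R w" by (intro tendsto_intros s0)
  then have lim: "(\<lambda>k. x + s k *\<^sub>R w) \<longlonglongrightarrow> x" by simp
  have "(x + s k *\<^sub>R w - x) /\<^sub>R s k = w" for k using s(1)[of k] by simp
  then have v: "(\<lambda>k. (x + s k *\<^sub>R w - x) /\<^sub>R s k) \<longlonglongrightarrow> w" by simp
  show ?thesis
    by (rule LIMSEQ_unique[OF has_derivative_tangent_sequence[OF assms(1) _ lim s(1) v]
          has_derivative_tangent_sequence[OF assms(2) _ lim s(1) v]])
       (use assms(4) s in auto)
qed

text \<open>The extensions are chosen independently for each list of directions;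
  \<open>has_derivative_within_closure\<close> shows that they nevertheless fit together as a jet on
  the lateral boundary.\<close>

lemma smooth_extension:
  fixes \<Omega> :: "'a::euclidean_space set" and f :: "'a \<times> real \<Rightarrow> real"
  assumes \<Omega>: "open \<Omega>" "convex \<Omega>" and smooth: "smooth_up_to (\<Omega> \<times> {0<..<T}) (frontier \<Omega> \<times> {0<..<T}) f"
  obtains e where "\<And>bs z. bs \<in> lists Basis \<Longrightarrow> z \<in> \<Omega> \<times> {0<..<T} \<Longrightarrow> e bs z = pderivs bs f z"
    "\<And>bs z. bs \<in> lists Basis \<Longrightarrow> z \<in> closure \<Omega> \<times> {0<..<T} \<Longrightarrow>
       has_partials (closure \<Omega> \<times> {0<..<T}) (e bs) (\<lambda>b. e (b # bs) z) z"
proof -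
  let ?Y = "\<Omega> \<times> {0<..<T}" and ?X = "closure \<Omega> \<times> {0<..<T}"
  have X: "?Y \<union> frontier \<Omega> \<times> {0<..<T} = ?X"
    using \<Omega>(1) closure_subset[of \<Omega>] by (auto simp: frontier_def interior_open)
  have "\<forall>bs\<in>lists Basis. \<exists>g. continuous_on ?X g \<and> (\<forall>z\<in>?Y. g z = pderivs bs f z)"
    using smooth unfolding smooth_up_to_def X by blast
  then obtain e where e: "\<And>bs. bs \<in> lists Basis \<Longrightarrow> continuous_on ?X (e bs)"
    "\<And>bs z. bs \<in> lists Basis \<Longrightarrow> z \<in> ?Y \<Longrightarrow> e bs z = pderivs bs f z" by metis
  have sm: "smooth_on ?Y f" using smooth by (simp add: smooth_up_to_def)
  have "has_partials ?X (e bs) (\<lambda>b. e (b # bs) z) z" if bs: "bs \<in> lists Basis" and z: "z \<in> ?X" for bs z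
    unfolding has_partials_def
  proof (rule has_derivative_within_closure[where S = ?Y])
    show "convex ?Y" using \<Omega> by (simp add: convex_Times)
    show "?Y \<subseteq> ?X" using closure_subset by auto
    show "?X \<subseteq> closure ?Y" by (auto simp: closure_Times intro: subsetD[OF closure_subset])
    show "continuous_on ?X (e (b # bs))" if "b \<in> Basis" for b using e(1) that bs by simp
    show "(e bs has_derivative (\<lambda>h. \<Sum>b\<in>Basis. (h \<bullet> b) * e (b # bs) y)) (at y within ?Y)" if y: "y \<in> ?Y" for y
    proof -
      have "(e bs has_derivative (\<lambda>h. \<Sum>b\<in>Basis. (h \<bullet> b) * pderivs (b # bs) f y)) (at y within ?Y)"
        by (rule has_derivative_transform[OF y e(2)[OF bs] has_derivative_at_withinI[OF has_derivative_pderivs[OF sm y bs]]])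
      moreover have "(\<lambda>h. \<Sum>b\<in>Basis. (h \<bullet> b) * pderivs (b # bs) f y) = (\<lambda>h. \<Sum>b\<in>Basis. (h \<bullet> b) * e (b # bs) y)"
        using e(2)[OF _ y] bs by (intro ext sum.cong refl) (simp del: pderivs.simps)
      ultimately show ?thesis by (simp only:)
    qed
  qed (use e(1) bs z in auto)
  with e(2) show ?thesis by (rule that)
qed

theorem theorem3p8:
  fixes \<Omega> :: "(real ^ 'n) set" and T :: real and u :: "real ^ 'n \<Rightarrow> real \<Rightarrow> real"
  assumes "open \<Omega>" and "connected \<Omega>" and "convex \<Omega>"
    and "smooth_boundary \<Omega>" and "interior_cone_condition \<Omega>"
    and "0 < T"
    and smooth: "smooth_up_to (\<Omega> \<times> {0<..<T}) (frontier \<Omega> \<times> {0<..<T}) (\<lambda>(x, t). u x t)"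
    and cont: "continuous_on (closure \<Omega> \<times> {0..<T}) (\<lambda>(x, t). u x t)"
    and pos: "\<And>x t. x \<in> \<Omega> \<Longrightarrow> t \<in> {0<..<T} \<Longrightarrow> 0 < u x t"
    and heat: "\<And>x t. x \<in> \<Omega> \<Longrightarrow> t \<in> {0<..<T} \<Longrightarrow>
                 deriv (\<lambda>s. u x s) t - laplacian (\<lambda>y. u y t) x = 0"
    and neumann: "\<And>x t. x \<in> frontier \<Omega> \<Longrightarrow> t \<in> {0<..<T} \<Longrightarrow>
                 has_normal_derivative \<Omega> (\<lambda>y. u y t) 0 x"
    and grad_bounded: "(\<lambda>(x, t). grad (\<lambda>y. u y t) x) \<in> L_infinity (\<Omega> \<times> {0<..<T})"
    and sobolev: "(\<lambda>t x. u x t) \<in> L2_sobolev2 T 4 \<Omega>"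
  shows "\<forall>x\<in>\<Omega>. \<forall>\<tau>\<in>{0<..<T}.
           laplacian (\<lambda>y. ln (u y \<tau>)) x
             = deriv (\<lambda>s. u x s) \<tau> / u x \<tau> - (norm (grad (\<lambda>y. u y \<tau>) x))\<^sup>2 / (u x \<tau>)\<^sup>2
           \<and> deriv (\<lambda>s. u x s) \<tau> / u x \<tau> - (norm (grad (\<lambda>y. u y \<tau>) x))\<^sup>2 / (u x \<tau>)\<^sup>2
             \<ge> - real CARD('n) / (2 * \<tau>)"
proof -
  let ?Y = "\<Omega> \<times> {0<..<T}" and ?X = "closure \<Omega> \<times> {0<..<T}"
  define f where "f = (\<lambda>(x, t). u x t)"
  have f: "f (x, t) = u x t" for x t by (simp add: f_def)
  have sm: "smooth_on ?Y f" using smooth by (simp add: smooth_up_to_def f_def)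
  obtain e where e: "\<And>bs z. bs \<in> lists Basis \<Longrightarrow> z \<in> ?Y \<Longrightarrow> e bs z = pderivs bs f z"
    and jet: "\<And>bs z. bs \<in> lists Basis \<Longrightarrow> z \<in> ?X \<Longrightarrow> has_partials ?X (e bs) (\<lambda>b. e (b # bs) z) z"
    using smooth_extension[OF assms(1,3) smooth] unfolding f_def[symmetric] by blast
  have ce: "continuous_on ?X (e bs)" if "bs \<in> lists Basis" for bs
    using jet[OF that] unfolding has_partials_def
    by (meson continuous_on_eq_continuous_within has_derivative_continuous)
  have YX: "?Y \<subseteq> ?X" using closure_subset by auto
  have XY: "?X \<subseteq> closure ?Y" by (auto simp: closure_Times intro: subsetD[OF closure_subset])
  have oY: "open ?Y" using assms(1) by (simp add: open_Times)
  \<comment> \<open>The Neumann condition speaks of u itself on the closure, so the extension must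
    be matched with the boundary values of u.\<close>
  have e0: "e [] z = f z" if "z \<in> ?X" for z
  proof (rule continuous_eq_on_closure[OF ce _ YX XY _ that])
    show "continuous_on ?X f" unfolding f_def by (rule continuous_on_subset[OF cont]) auto
  qed (use e in auto)
  \<comment> \<open>Positivity is assumed only inside \<Omega>; continuity leaves a weak inequality
    on the boundary, which is why a constant is added below.\<close>
  have nonneg: "0 \<le> e [] z" if z: "z \<in> ?X" for z
  proof -
    have "e [] z = \<bar>e [] z\<bar>"
    proof (rule continuous_eq_on_closure[OF _ _ YX XY _ z])
      show "continuous_on ?X (\<lambda>z. \<bar>e [] z\<bar>)" by (intro continuous_intros ce) simp
      show "e [] y = \<bar>e [] y\<bar>" if "y \<in> ?Y" for y
        using e[of "[]" y] that pos by (auto simp: f less_imp_le)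
    qed (use ce in simp)
    then show ?thesis by linarith
  qed
  have grad_e: "pderivs [i] (\<lambda>y. u y t) x = e [(i, 0)] (x, t)"
    and hess_e: "pderivs [i, i] (\<lambda>y. u y t) x = e [(i, 0), (i, 0)] (x, t)"
    if "x \<in> \<Omega>" "t \<in> {0<..<T}" "i \<in> Basis" for x t i
    using pderivs_slice[OF assms(1) that(2) sm _ that(1), of "[i]"] pderivs_slice[OF assms(1) that(2) sm _ that(1), of "[i, i]"]
      e[of "[(i, 0)]" "(x, t)"] e[of "[(i, 0), (i, 0)]" "(x, t)"] that
    by (simp_all add: f del: pderivs.simps)
  have time_e: "deriv (\<lambda>s. u x s) t = e [(0, 1)] (x, t)" if "x \<in> \<Omega>" "t \<in> {0<..<T}" for x t
  proof -
    have "pderivs [] f differentiable at (x, t)" using sm that unfolding smooth_on_def by blast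
    then show ?thesis using deriv_time_slice[of f x t] e[of "[(0, 1)]" "(x, t)"] that by (simp add: f)
  qed
  have heat_e: "e [(0, 1)] z = (\<Sum>i\<in>Basis. e [(i, 0), (i, 0)] z)" if z: "z \<in> ?X" for z
  proof (rule continuous_eq_on_closure[OF _ _ YX XY _ z])
    show "continuous_on ?X (\<lambda>z. \<Sum>i\<in>Basis. e [(i, 0), (i, 0)] z)" by (intro continuous_intros ce) simp
    show "continuous_on ?X (e [(0, 1)])" by (intro ce) simp
    show "e [(0, 1)] y = (\<Sum>i\<in>Basis. e [(i, 0), (i, 0)] y)" if "y \<in> ?Y" for y
    proof -
      obtain x t where xt: "y = (x, t)" by (cases y)
      with that have y: "y = (x, t)" "x \<in> \<Omega>" "t \<in> {0<..<T}" by auto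
      then show ?thesis using heat[OF y(2,3)] time_e[OF y(2,3)] hess_e[OF y(2,3)]
        by (simp add: laplacian_def del: pderivs.simps)
    qed
  qed
  have neumann_e: "(\<Sum>i\<in>Basis. (grad \<phi> x \<bullet> i) * e [(i, 0)] (x, t)) = 0"
    if x: "x \<in> frontier \<Omega>" and t: "t \<in> {0<..<T}" and U: "x \<in> U" and ldf: "local_defining_function \<Omega> U \<phi>" for x t U \<phi>
  proof -
    let ?N = "grad \<phi> x"
    have xX: "(x, t) \<in> ?X" using x t by (simp add: frontier_def)
    have N: "?N \<noteq> 0" using ldf U by (auto simp: local_defining_function_def)
    have "outward_unit_normal \<Omega> x (?N /\<^sub>R norm ?N)"
      using x U ldf unfolding outward_unit_normal_def by blast
    then obtain L where L: "((\<lambda>y. u y t) has_derivative L) (at x within closure \<Omega>)" "L (?N /\<^sub>R norm ?N) = 0"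
      using neumann[OF x t] unfolding has_normal_derivative_def by blast
    let ?L = "\<lambda>h :: (real ^ 'n). \<Sum>b\<in>Basis. ((h, 0) \<bullet> b) * e [b] (x, t)"
    have "((\<lambda>y. (y, t)) has_derivative (\<lambda>h. (h, 0))) (at x within closure \<Omega>)" by (auto intro!: derivative_eq_intros)
    moreover have "(e [] has_derivative (\<lambda>h. \<Sum>b\<in>Basis. (h \<bullet> b) * e [b] (x, t))) (at (x, t) within (\<lambda>y. (y, t)) ` closure \<Omega>)"
      by (rule has_derivative_subset[OF jet[of "[]", OF _ xX, unfolded has_partials_def]]) (use t in auto)
    ultimately have "((\<lambda>y. e [] (y, t)) has_derivative ?L) (at x within closure \<Omega>)"
      by (rule has_derivative_in_compose)
    then have L': "((\<lambda>y. u y t) has_derivative ?L) (at x within closure \<Omega>)"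
      by (rule has_derivative_transform[rotated 2]) (use e0 t x in \<open>auto simp: f frontier_def\<close>)
    have "?N \<bullet> (- ?N) < 0" using N by simp
    then obtain d where d: "d > 0" "\<And>h. 0 < h \<Longrightarrow> h < d \<Longrightarrow> x + h *\<^sub>R (- ?N) \<in> closure \<Omega>"
      using defining_function_direction(1)[OF ldf assms(1) U x] closure_subset[of \<Omega>] by blast
    \<comment> \<open>The inner normal is used since it points into the domain; linearity then
      carries the vanishing over to both signs.\<close>
    have "L (- ?N) = ?L (- ?N)" by (rule has_derivative_direction_unique[OF L(1) L' d])
    moreover have "L (- ?N) = 0"
    proof -
      have "- ?N = (- norm ?N) *\<^sub>R (?N /\<^sub>R norm ?N)" using N by simp
      then have "L (- ?N) = (- norm ?N) *\<^sub>R L (?N /\<^sub>R norm ?N)"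
        using linear_scale[OF has_derivative_linear[OF L(1)]] by metis
      then show ?thesis using L(2) by simp
    qed
    ultimately show ?thesis by (simp add: sum_inner_Basis_prod sum_negf)
  qed
  have shifted: "e [(0, 1)] (x, \<tau>) / (u x \<tau> + \<epsilon>) - (\<Sum>j\<in>Basis. (e [(j, 0)] (x, \<tau>) / (u x \<tau> + \<epsilon>))\<^sup>2)
      \<ge> - real CARD('n) / (2 * \<tau>)" if x: "x \<in> \<Omega>" and \<tau>: "\<tau> \<in> {0<..<T}" and \<epsilon>: "\<epsilon> > 0" for x \<tau> \<epsilon>
  proof -
    \<comment> \<open>Adding a constant changes only the entry of order zero, and neither the heat
      equation nor the Neumann condition involves it.\<close>
    define g where "g bs z = e bs z + (if bs = [] then \<epsilon> else 0)" for bs z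
    interpret neumann_heat_jet \<Omega> T g
    proof
      show "has_partials ?X (g bs) (\<lambda>b. g (b # bs) z) z" if "bs \<in> lists Basis" "z \<in> ?X" for bs z
        using has_derivative_add[OF jet[OF that, unfolded has_partials_def] has_derivative_const]
        by (simp add: has_partials_def g_def[abs_def])
      show "g (a # b # bs) z = g (b # a # bs) z"
        if "a \<in> Basis" "b \<in> Basis" "bs \<in> lists Basis" "z \<in> ?Y" for a b bs z
        using pderivs_commute[OF oY sm that(4,3,1,2)] e[OF _ that(4)] that by (simp add: g_def del: pderivs.simps)
      show "0 < g [] z" if "z \<in> ?X" for z using nonneg[OF that] \<epsilon> by (simp add: g_def)
    qed (use assms(1,3,4) heat_e neumann_e in \<open>auto simp: g_def\<close>)
    have "(x, \<tau>) \<in> ?X" using x \<tau> closure_subset by auto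
    then show ?thesis using li_yau[OF x, of \<tau>] \<tau> by (simp add: f1_def g_def e0 f)
  qed
  show ?thesis
  proof (intro ballI conjI)
    fix x \<tau> assume x: "x \<in> \<Omega>" and \<tau>: "\<tau> \<in> {0<..<T}"
    have "pderivs bs (\<lambda>y. u y \<tau>) differentiable at y" if bs: "bs \<in> lists Basis" and y: "y \<in> \<Omega>" for bs y
    proof -
      let ?F = "pderivs (map (\<lambda>b. (b, 0)) bs) f"
      have "map (\<lambda>b. (b, 0 :: real)) bs \<in> lists Basis" using bs by auto
      then have "?F differentiable at (y, \<tau>)" using sm y \<tau> unfolding smooth_on_def by blast
      then obtain D where F: "(?F has_derivative D) (at (y, \<tau>))" unfolding differentiable_def by blast
      have "((\<lambda>y. (y, \<tau>)) has_derivative (\<lambda>h. (h, 0))) (at y)" by (auto intro!: derivative_eq_intros)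
      from has_derivative_compose[OF this F]
      have "((\<lambda>y. ?F (y, \<tau>)) has_derivative (\<lambda>h. D (h, 0))) (at y)" .
      then have "(pderivs bs (\<lambda>y. u y \<tau>) has_derivative (\<lambda>h. D (h, 0))) (at y)"
        by (rule has_derivative_transform_within_open[OF _ assms(1) y])
           (use pderivs_slice[OF assms(1) \<tau> sm bs] in \<open>simp add: f\<close>)
      then show ?thesis unfolding differentiable_def by blast
    qed
    from laplacian_ln[OF assms(1) this pos[OF _ \<tau>] x]
    show "laplacian (\<lambda>y. ln (u y \<tau>)) x
        = deriv (\<lambda>s. u x s) \<tau> / u x \<tau> - (norm (grad (\<lambda>y. u y \<tau>) x))\<^sup>2 / (u x \<tau>)\<^sup>2"
      using heat[OF x \<tau>] by simp
    have u: "u x \<tau> > 0" by (rule pos[OF x \<tau>])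
    \<comment> \<open>The summand 0 presents the quotient as the value at \<epsilon> = 0 of the
      shifted one; the limit is harmless because u is positive at the interior point x.\<close>
    have grad: "(norm (grad (\<lambda>y. u y \<tau>) x))\<^sup>2 / (u x \<tau>)\<^sup>2 = (\<Sum>j\<in>Basis. (e [(j, 0)] (x, \<tau>) / (u x \<tau> + 0))\<^sup>2)"
      by (simp add: norm_grad_power2 grad_e[OF x \<tau>] power_divide sum_divide_distrib del: pderivs.simps)
    have "- real CARD('n) / (2 * \<tau>) \<le> e [(0, 1)] (x, \<tau>) / (u x \<tau> + 0) - (\<Sum>j\<in>Basis. (e [(j, 0)] (x, \<tau>) / (u x \<tau> + 0))\<^sup>2)"
    proof (rule tendsto_lowerbound)
      show "((\<lambda>\<epsilon>. e [(0, 1)] (x, \<tau>) / (u x \<tau> + \<epsilon>) - (\<Sum>j\<in>Basis. (e [(j, 0)] (x, \<tau>) / (u x \<tau> + \<epsilon>))\<^sup>2))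
        \<longlongrightarrow> e [(0, 1)] (x, \<tau>) / (u x \<tau> + 0) - (\<Sum>j\<in>Basis. (e [(j, 0)] (x, \<tau>) / (u x \<tau> + 0))\<^sup>2)) (at_right 0)"
        using u by (intro tendsto_intros) auto
      show "\<forall>\<^sub>F \<epsilon> in at_right 0. - real CARD('n) / (2 * \<tau>) \<le> e [(0, 1)] (x, \<tau>) / (u x \<tau> + \<epsilon>)
          - (\<Sum>j\<in>Basis. (e [(j, 0)] (x, \<tau>) / (u x \<tau> + \<epsilon>))\<^sup>2)"
        using shifted[OF x \<tau>] by (intro eventually_at_rightI[of 0 1]) auto
    qed simp
    then show "deriv (\<lambda>s. u x s) \<tau> / u x \<tau> - (norm (grad (\<lambda>y. u y \<tau>) x))\<^sup>2 / (u x \<tau>)\<^sup>2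
             \<ge> - real CARD('n) / (2 * \<tau>)"
      unfolding grad time_e[OF x \<tau>] by simp
  qed
qed

end
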